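(* Let $(\mathbf{x},\mathbf{y},B,\mathbf{Z})$ be a generalized seed over a semifield $\mathbb{P}$, with $d_i=\deg Z_i$ and $D=(d_i\delta_{ij})$, placed at the initial vertex $t_0$ of $\mathbb{T}_n$. Let $\mathbf{g}^t_j=(g^t_{ij})_i$ be the $g$-vectors of the generalized cluster algebra $\mathcal{A}(\mathbf{x},\mathbf{y},B,\mathbf{Z})$, let ${}^L\mathbf{g}^t_j=({}^Lg^t_{ij})_i$ be the $g$-vectors of its left-companion cluster algebra $\mathcal{A}(\mathbf{x}^{1/\mathbf{d}},\mathbf{y},DB)$, and let ${}^R\mathbf{g}^t_j=({}^Rg^t_{ij})_i$ be the $g$-vectors of its right-companion cluster algebra $\mathcal{A}(\mathbf{x},\mathbf{y}^{\mathbf{d}},BD)$, where $\mathbf{x}^{1/\mathbf{d}}=(x_1^{1/d_1},\dots,x_n^{1/d_n})$ and $\mathbf{y}^{\mathbf{d}}=(y_1^{d_1},\dots,y_n^{d_n})$. Then for all $t\in\mathbb{T}_n$ and $1\le i,j\le n$: $${}^Rg^t_{ij}=g^t_{ij}\qquad\text{and}\qquad {}^Lg^t_{ij}=d_i\,g^t_{ij}\,d_j^{-1} .$$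
   Context: Semifields. A semifield is a multiplicative abelian group $\mathbb{P}$ with an associative, commutative operation $\oplus$ over which multiplication distributes. $\mathbb{P}$ is torsion-free, $\mathbb{ZP}$ is its group ring (a domain), $\mathbb{QP}$ its field of fractions. $\mathrm{Trop}(u_1,\dots,u_m)$ is the free abelian multiplicative group on the $u_j$ with $\prod u_j^{a_j}\oplus\prod u_j^{b_j}=\prod u_j^{\min(a_j,b_j)}$. Write $[b]_+=\max(b,0)$. Generalized seeds. A generalized seed $(\mathbf{x},\mathbf{y},B,\mathbf{Z})$ over $\mathbb{P}$ consists of: algebraically independent elements $\mathbf{x}=(x_1,\dots,x_n)$ (cluster variables) of a degree-$n$ purely transcendental extension $\mathcal{F}$ of $\mathbb{QP}$ (identified with $\mathbb{QP}(\mathbf{x})$); $\mathbf{y}=(y_1,\dots,y_n)\in\mathbb{P}^n$ (coefficients); a skew-symmetrizable integer $n\times n$ matrix $B=(b_{ij})$; and polynomials $\mathbf{Z}=(Z_1,\dots,Z_n)$, $Z_i(u)=\sum_{s=0}^{d_i}z_{i,s}u^s$ with $d_i\ge1$, $z_{i,s}\in\mathbb{P}$, $z_{i,0}=z_{i,d_i}=1$. Put $\mathbf{z}=(z_{i,s})$ and $Z_i|_{\mathbb{P}}(y)=\bigoplus_{s=0}^{d_i}z_{i,s}y^s$ for $y\in\mathbb{P}$. Mutation. $\mu_k(\mathbf{x},\mathbf{y},B,\mathbf{Z})=(\mathbf{x}',\mathbf{y}',B',\mathbf{Z}')$, where $x_i'=x_i$ for $i\ne k$ and $x_k'x_k=\big(\prod_i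 x_i^{[-b_{ik}]_+}\big)^{d_k}\frac{Z_k(\hat y_k)}{Z_k|_{\mathbb{P}}(y_k)}$ with $\hat y_k=y_k\prod_i x_i^{b_{ik}}$; $y_k'=y_k^{-1}$ and $y_j'=y_j(y_k^{d_k})^{[b_{kj}]_+}Z_k|_{\mathbb{P}}(y_k)^{-b_{kj}}$ for $j\ne k$; $b'_{ij}=-b_{ij}$ if $i=k$ or $j=k$, and $b'_{ij}=b_{ij}+[b_{ik}]_+d_kb_{kj}+b_{ik}d_k[-b_{kj}]_+$ otherwise; $Z_i'=Z_i$ for $i\neq k$ and $Z_k'(u)=u^{d_k}Z_k(u^{-1})$. Patterns. $\mathbb{T}_n$ is the $n$-regular tree with edges labeled by $1,\dots,n$ so that the edges at each vertex have distinct labels. A generalized cluster pattern assigns to each $t\in\mathbb{T}_n$ a generalized seed $(\mathbf{x}^t,\mathbf{y}^t,B^t,\mathbf{Z}^t)$ so that seeds at the ends of an edge labeled $k$ are related by $\mu_k$; it is determined by the seed at the initial vertex $t_0$ (for which the superscript is dropped). The generalized cluster algebra $\mathcal{A}(\mathbf{x},\mathbf{y},B,\mathbf{Z})$ is the $\mathbb{ZP}$-subalgebra of $\mathcal{F}$ generated by all $x_i^t$. An ordinary seed $(\mathbf{x},\mathbf{y},B)$, its cluster pattern and its cluster algebra $\mathcal{A}(\mathbf{x},\mathbf{y},B)$ are the special case $Z_i(u)=1+u$ for all $i$ (so all $d_i=1$, and there are no variables $z_{i,s}$ with $0<s<d_i$). $g$-vectors. Regard $x_i$, $y_i$ and $z_{i,s}$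 ($0<s<d_i$) as independent indeterminates. $X$-functions $X^t_i\in\mathbb{Q}(\mathbf{x},\mathbf{y},\mathbf{z})$ are the cluster variables obtained by taking $\mathbb{P}=\mathrm{Trop}(\mathbf{y},\mathbf{z})$; one has $X_i^t\in\mathbb{Z}[\mathbf{x}^{\pm1},\mathbf{y},\mathbf{z}]$. For the $\mathbb{Z}^n$-grading $\deg x_i=\mathbf{e}_i$, $\deg y_j=-(j\text{-th column of the initial exchange matrix})$, $\deg z_{i,s}=0$, each $X_j^t$ is homogeneous, and its degree $\mathbf{g}^t_j=(g^t_{ij})_i\in\mathbb{Z}^n$ is the $g$-vector. The $g$-vectors depend only on the initial exchange matrix and the degrees $d_i$; for an ordinary cluster algebra they are computed with its own initial cluster variables and coefficients regarded as the indeterminates (and its own initial exchange matrix in the grading). *)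

theory Defs
  imports
    "HOL-Analysis.Analysis"
    "HOL-Library.Poly_Mapping"
    "HOL-Library.Countable"
    "HOL-Computational_Algebra.Fraction_Field"
begin

section \<open>Semifields\<close>

class semifield = comm_monoid_mult + inverse +
  fixes semifield_add :: "'a \<Rightarrow> 'a \<Rightarrow> 'a" (infixl \<open>\<oplus>\<close> 65)
  assumes semifield_left_inverse: "inverse a * a = 1"
    and semifield_divide: "a / b = a * inverse b"
    and semifield_add_assoc: "(a \<oplus> b) \<oplus> c = a \<oplus> (b \<oplus> c)"
    and semifield_add_commute: "a \<oplus> b = b \<oplus> a"
    and semifield_distrib: "a * (b \<oplus> c) = (a * b) \<oplus> (a * c)"

text \<open>A semifield has no zero, so only nonempty sums make sense.\<close>

fun semifield_sum :: "'p::semifield list \<Rightarrow> 'p" where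
  "semifield_sum [] = undefined"
| "semifield_sum [a] = a"
| "semifield_sum (a # b # as) = a \<oplus> semifield_sum (b # as)"

text \<open>
  \<open>Trop m\<close> is the Laurent monomial with exponent vector \<open>m\<close>, so \<open>'v trop\<close> is the free abelian
  multiplicative group on \<open>'v\<close>.
\<close>

datatype 'v trop = Trop (expo: "'v \<Rightarrow>\<^sub>0 int")

lift_definition pointwise_min :: "('v \<Rightarrow>\<^sub>0 int) \<Rightarrow> ('v \<Rightarrow>\<^sub>0 int) \<Rightarrow> ('v \<Rightarrow>\<^sub>0 int)"
  is "\<lambda>a b v. min (a v) (b v)"
proof -
  fix a b :: "'v \<Rightarrow> int"
  assume "finite {v. a v \<noteq> 0}" "finite {v. b v \<noteq> 0}"
  then have "finite ({v. a v \<noteq> 0} \<union> {v. b v \<noteq> 0})" by simp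
  then show "finite {v. min (a v) (b v) \<noteq> 0}"
    by (rule rev_finite_subset) (auto simp: min_def)
qed

instantiation trop :: (type) semifield
begin

definition "1 = Trop 0"
definition "a * b = Trop (expo a + expo b)"
definition "inverse a = Trop (- expo a)"
definition "divide a b = Trop (expo a - expo b)"
definition "a \<oplus> b = Trop (pointwise_min (expo a) (expo b))"

instance
proof
  fix a b c :: "'a trop"
  show "a * b * c = a * (b * c)" "a * b = b * a" "1 * a = a"
    by (simp_all add: times_trop_def one_trop_def ac_simps)
  show "inverse a * a = 1" "divide a b = a * inverse b"
    by (simp_all add: times_trop_def one_trop_def inverse_trop_def divide_trop_def)
  have "pointwise_min (pointwise_min u v) w = pointwise_min u (pointwise_min v w)"
    "pointwise_min u v = pointwise_min v u"
    "u + pointwise_min v w = pointwise_min (u + v) (u + w)" for u v w :: "'a \<Rightarrow>\<^sub>0 int"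
    by (transfer; auto simp: min_def fun_eq_iff)+
  then show "(a \<oplus> b) \<oplus> c = a \<oplus> (b \<oplus> c)" "a \<oplus> b = b \<oplus> a"
    "a * (b \<oplus> c) = (a * b) \<oplus> (a * c)"
    unfolding semifield_add_trop_def times_trop_def by simp_all
qed

end


section \<open>Generalized seeds\<close>

text \<open>
  The group ring of a semifield \<open>'p\<close> and its field of fractions are not constructed. They are
  identified with their images in the ambient field under a multiplicative map \<open>\<iota>\<close> whose values
  are linearly independent over the integers: this says exactly that \<open>\<iota>\<close> extends to an
  injective ring homomorphism on the group ring.
\<close>

definition coefficient_embedding :: "('p::semifield \<Rightarrow> 'f::field) \<Rightarrow> bool" where
  "coefficient_embedding \<iota> \<longleftrightarrow>
     (\<forall>p q. \<iota> (p * q) = \<iota> p * \<iota> q) \<and>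
     (\<forall>A c. finite A \<longrightarrow> (\<Sum>p\<in>A. of_int (c p) * \<iota> p) = 0 \<longrightarrow> (\<forall>p\<in>A. c p = (0::int)))"

definition subfield_set :: "'f::field set \<Rightarrow> bool" where
  "subfield_set K \<longleftrightarrow> 1 \<in> K \<and>
     (\<forall>a\<in>K. \<forall>b\<in>K. a - b \<in> K \<and> a * b \<in> K) \<and> (\<forall>a\<in>K. inverse a \<in> K)"

definition coefficient_field :: "('p::semifield \<Rightarrow> 'f::field) \<Rightarrow> 'f set" where
  "coefficient_field \<iota> = subfield_set hull range \<iota>"

definition algebraically_independent_over :: "'f::field set \<Rightarrow> ('n::finite \<Rightarrow> 'f) \<Rightarrow> bool" where
  "algebraically_independent_over K x \<longleftrightarrow>
     (\<forall>M c. finite M \<longrightarrow> (\<forall>m\<in>M. c m \<in> K) \<longrightarrow>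
        (\<Sum>m\<in>M. c m * (\<Prod>i\<in>UNIV. x i ^ (m i :: nat))) = 0 \<longrightarrow> (\<forall>m\<in>M. c m = 0))"

text \<open>
  The entry in row \<open>i\<close> and column \<open>j\<close> of the exchange matrix is \<open>exch S $ i $ j\<close>.  The exchange
  polynomial with coefficients \<open>z\<^sub>0, \<dots>, z\<^sub>d\<close> is the list \<open>[z\<^sub>0, \<dots>, z\<^sub>d]\<close>, so that
  \<open>u\<^sup>d Z(1/u)\<close> is the reversed list.
\<close>

record ('f, 'p, 'n) seed =
  cluster :: "'n \<Rightarrow> 'f"
  coeffs :: "'n \<Rightarrow> 'p"
  exch :: "int ^ 'n ^ 'n"
  polys :: "'n \<Rightarrow> 'p list"

definition degs :: "('f, 'p, 'n::finite) seed \<Rightarrow> 'n \<Rightarrow> nat" where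
  "degs S i = length (polys S i) - 1"

definition skew_symmetrizable :: "int ^ 'n ^ 'n::finite \<Rightarrow> bool" where
  "skew_symmetrizable B \<longleftrightarrow>
     (\<exists>r :: 'n \<Rightarrow> int. (\<forall>i. r i > 0) \<and> (\<forall>i j. r i * B $ i $ j = - (r j * B $ j $ i)))"

definition generalized_seed ::
  "('p::semifield \<Rightarrow> 'f::field) \<Rightarrow> ('f, 'p, 'n::finite) seed \<Rightarrow> bool" where
  "generalized_seed \<iota> S \<longleftrightarrow>
     coefficient_embedding \<iota> \<and>
     algebraically_independent_over (coefficient_field \<iota>) (cluster S) \<and>
     subfield_set hull (coefficient_field \<iota> \<union> range (cluster S)) = UNIV \<and>
     skew_symmetrizable (exch S) \<and>
     (\<forall>i. degs S i \<ge> 1 \<and> hd (polys S i) = 1 \<and> last (polys S i) = 1)"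


section \<open>Mutation\<close>

definition eval_field :: "('p::semifield \<Rightarrow> 'f::field) \<Rightarrow> 'p list \<Rightarrow> 'f \<Rightarrow> 'f" where
  "eval_field \<iota> z u = (\<Sum>s<length z. \<iota> (z ! s) * u ^ s)"

definition eval_semifield :: "'p::semifield list \<Rightarrow> 'p \<Rightarrow> 'p" where
  "eval_semifield z y = semifield_sum (map (\<lambda>s. z ! s * y ^ s) [0..<length z])"

abbreviation pos_part :: "int \<Rightarrow> int" (\<open>[_]\<^sub>+\<close>) where
  "[b]\<^sub>+ \<equiv> max b 0"

definition yhat ::
  "('p::semifield \<Rightarrow> 'f::field) \<Rightarrow> ('f, 'p, 'n::finite) seed \<Rightarrow> 'n \<Rightarrow> 'f" where
  "yhat \<iota> S k = \<iota> (coeffs S k) * (\<Prod>i\<in>UNIV. cluster S i powi (exch S $ i $ k))"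

definition mutate ::
  "('p::semifield \<Rightarrow> 'f::field) \<Rightarrow> 'n::finite \<Rightarrow> ('f, 'p, 'n) seed \<Rightarrow> ('f, 'p, 'n) seed" where
  "mutate \<iota> k S =
    (let x = cluster S; y = coeffs S; B = exch S; Z = polys S; d = degs S;
         Zy = eval_semifield (Z k) (y k)
     in \<lparr> cluster = (\<lambda>i. if i = k
            then (\<Prod>l\<in>UNIV. x l powi [- (B $ l $ k)]\<^sub>+) ^ d k
                   * (eval_field \<iota> (Z k) (yhat \<iota> S k) / \<iota> Zy) / x k
            else x i),
          coeffs = (\<lambda>j. if j = k then inverse (y k)
            else y j * (y k ^ d k) powi [B $ k $ j]\<^sub>+ * Zy powi (- (B $ k $ j))),
          exch = (\<chi> i j. if i = k \<or> j = k then - (B $ i $ j)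
            else B $ i $ j + [B $ i $ k]\<^sub>+ * int (d k) * B $ k $ j
                   + B $ i $ k * int (d k) * [- (B $ k $ j)]\<^sub>+),
          polys = Z(k := rev (Z k)) \<rparr>)"


section \<open>The regular tree and cluster patterns\<close>

text \<open>
  The \<open>n\<close>-regular tree is realised as the Cayley graph of the free product of \<open>n\<close> copies of the
  group of order two: vertices are the words without two equal consecutive letters, and an
  edge labelled \<open>k\<close> joins a word to its extension by the letter \<open>k\<close>.
\<close>

typedef 'n tree_vertex = "{w :: 'n list. distinct_adj w}"
  morphisms word_of vertex_of
  by (rule exI[of _ "[]"]) simp

definition tree_edge :: "'n \<Rightarrow> 'n tree_vertex \<Rightarrow> 'n tree_vertex \<Rightarrow> bool" where
  "tree_edge k t t' \<longleftrightarrow> word_of t' = word_of t @ [k] \<or> word_of t = word_of t' @ [k]"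

lemma tree_edge_sym: "tree_edge k t t' \<longleftrightarrow> tree_edge k t' t"
  by (auto simp: tree_edge_def)

lemma tree_edge_unique: "\<exists>!t'. tree_edge k t t'"
proof -
  have adj: "distinct_adj (word_of s)" for s :: "'a tree_vertex"
    using word_of by auto
  show ?thesis
  proof (cases "word_of t \<noteq> [] \<and> last (word_of t) = k")
    case True
    then have w: "word_of t = butlast (word_of t) @ [k]"
      by (metis append_butlast_last_id)
    then have "distinct_adj (butlast (word_of t))"
      by (metis adj distinct_adj_appendD1)
    then have "tree_edge k t (vertex_of (butlast (word_of t)))"
      using w by (auto simp: tree_edge_def vertex_of_inverse)
    moreover have "s = vertex_of (butlast (word_of t))" if "tree_edge k t s" for s
    proof -
      have "word_of s \<noteq> word_of t @ [k]"
      proof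
        assume "word_of s = word_of t @ [k]"
        then have "word_of s = butlast (word_of t) @ [k, k]"
          using w by (metis append.assoc append_Cons append_Nil)
        then have "distinct_adj (butlast (word_of t) @ [k, k])" using adj[of s] by simp
        then show False by (simp add: distinct_adj_append_iff)
      qed
      then have "word_of s = butlast (word_of t)"
        using that by (auto simp: tree_edge_def)
      then show ?thesis by (metis word_of_inverse)
    qed
    ultimately show ?thesis by blast
  next
    case False
    then have "distinct_adj (word_of t @ [k])"
      using adj[of t] by (auto simp: distinct_adj_append_iff)
    then have "tree_edge k t (vertex_of (word_of t @ [k]))"
      by (auto simp: tree_edge_def vertex_of_inverse)
    moreover have "s = vertex_of (word_of t @ [k])" if "tree_edge k t s" for s
    proof -
      have "word_of s = word_of t @ [k]" using that False by (auto simp: tree_edge_def)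
      then show ?thesis by (metis word_of_inverse)
    qed
    ultimately show ?thesis by blast
  qed
qed

definition cluster_pattern ::
  "('p::semifield \<Rightarrow> 'f::field) \<Rightarrow> ('n::finite tree_vertex \<Rightarrow> ('f, 'p, 'n) seed) \<Rightarrow> bool" where
  "cluster_pattern \<iota> P \<longleftrightarrow> (\<forall>k t t'. tree_edge k t t' \<longrightarrow> P t' = mutate \<iota> k (P t))"

definition pattern_from ::
  "('p::semifield \<Rightarrow> 'f::field) \<Rightarrow> 'n::finite tree_vertex \<Rightarrow> ('f, 'p, 'n) seed
     \<Rightarrow> 'n tree_vertex \<Rightarrow> ('f, 'p, 'n) seed" where
  "pattern_from \<iota> t0 S = (THE P. cluster_pattern \<iota> P \<and> P t0 = S)"


section \<open>X-functions\<close>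

text \<open>
  \<open>Coef (Y i)\<close> and \<open>Coef (Z i s)\<close> stand for the indeterminates \<open>y\<^sub>i\<close> and \<open>z\<^sub>i\<^sub>,\<^sub>s\<close>.  To have a type not
  depending on the degrees \<open>d\<^sub>i\<close>, an indeterminate \<open>Z i s\<close> is present for all \<open>s\<close>; only those with
  \<open>0 < s < d\<^sub>i\<close> ever occur.
\<close>

datatype 'n coef_var = Y 'n | Z 'n nat

datatype 'n var = X 'n | Coef "'n coef_var"

text \<open>
  An arbitrary linear order on the indeterminates, used only because the library derives the
  absence of zero divisors in a ring of Laurent polynomials from it.
\<close>

fun var_code :: "'n::countable var \<Rightarrow> nat \<times> nat \<times> nat" where
  "var_code (X i) = (0, to_nat i, 0)"
| "var_code (Coef (Y i)) = (1, to_nat i, 0)"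
| "var_code (Coef (Z i s)) = (2, to_nat i, s)"

lemma var_code_inj: "var_code v = var_code w \<Longrightarrow> v = w"
  by (cases v rule: var_code.cases; cases w rule: var_code.cases) auto

instantiation var :: (countable) linorder
begin

definition "v \<le> w \<longleftrightarrow> to_nat (var_code v) \<le> to_nat (var_code w)"
definition "v < w \<longleftrightarrow> to_nat (var_code v) < to_nat (var_code w)"

instance
  by standard (auto simp: less_eq_var_def less_var_def intro: var_code_inj)

end

text \<open>
  Laurent polynomials in \<open>x, y, z\<close> form the group ring of the additive group of exponent vectors;
  their field of fractions is the field of rational functions in \<open>x, y, z\<close>.
\<close>

type_synonym 'n laurent = "('n var \<Rightarrow>\<^sub>0 int) \<Rightarrow>\<^sub>0 int"
type_synonym 'n ratfun = "'n laurent fract"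

definition indet :: "'n::finite var \<Rightarrow> 'n ratfun" where
  "indet v = Fract (Poly_Mapping.single (Poly_Mapping.single v 1) 1) 1"

definition trop_to_ratfun :: "'n::finite coef_var trop \<Rightarrow> 'n ratfun" where
  "trop_to_ratfun p =
     (\<Prod>c\<in>Poly_Mapping.keys (expo p). indet (Coef c) powi Poly_Mapping.lookup (expo p) c)"

definition trop_gen :: "'v \<Rightarrow> 'v trop" where
  "trop_gen v = Trop (Poly_Mapping.single v 1)"

definition universal_seed ::
  "int ^ 'n ^ 'n \<Rightarrow> ('n::finite \<Rightarrow> nat) \<Rightarrow> ('n ratfun, 'n coef_var trop, 'n) seed" where
  "universal_seed B d =
     \<lparr> cluster = (\<lambda>i. indet (X i)),
       coeffs = (\<lambda>i. trop_gen (Y i)),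
       exch = B,
       polys = (\<lambda>i. map (\<lambda>s. if s = 0 \<or> s = d i then 1 else trop_gen (Z i s)) [0..<d i + 1]) \<rparr>"

definition X_function ::
  "int ^ 'n ^ 'n \<Rightarrow> ('n::finite \<Rightarrow> nat) \<Rightarrow> 'n tree_vertex \<Rightarrow> 'n tree_vertex \<Rightarrow> 'n \<Rightarrow> 'n ratfun" where
  "X_function B d t0 t j =
     cluster (pattern_from trop_to_ratfun t0 (universal_seed B d) t) j"


section \<open>The grading and g-vectors\<close>

fun var_degree :: "int ^ 'n ^ 'n \<Rightarrow> 'n::finite var \<Rightarrow> int ^ 'n" where
  "var_degree B (X i) = axis i 1"
| "var_degree B (Coef (Y j)) = - column j B"
| "var_degree B (Coef (Z i s)) = 0"

definition monomial_degree :: "int ^ 'n ^ 'n \<Rightarrow> ('n::finite var \<Rightarrow>\<^sub>0 int) \<Rightarrow> int ^ 'n" where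
  "monomial_degree B m =
     (\<Sum>v\<in>Poly_Mapping.keys m. Poly_Mapping.lookup m v *s var_degree B v)"

definition laurent_homogeneous :: "int ^ 'n ^ 'n \<Rightarrow> 'n::finite laurent \<Rightarrow> int ^ 'n \<Rightarrow> bool" where
  "laurent_homogeneous B p g \<longleftrightarrow> (\<forall>m\<in>Poly_Mapping.keys p. monomial_degree B m = g)"

text \<open>
  The grading of the Laurent polynomial ring, extended to rational functions by giving a
  quotient of nonzero homogeneous elements the difference of the degrees.  On Laurent
  polynomials this is the original grading, by lemma \<open>homogeneous_laurent_iff\<close> below.
\<close>

definition homogeneous :: "int ^ 'n ^ 'n \<Rightarrow> 'n::finite ratfun \<Rightarrow> int ^ 'n \<Rightarrow> bool" where
  "homogeneous B f g \<longleftrightarrow>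
     (\<exists>p q a b. p \<noteq> 0 \<and> q \<noteq> 0 \<and> laurent_homogeneous B p a \<and> laurent_homogeneous B q b \<and>
        f = Fract p q \<and> g = a - b)"

definition gvec ::
  "int ^ 'n ^ 'n \<Rightarrow> ('n::finite \<Rightarrow> nat) \<Rightarrow> 'n tree_vertex \<Rightarrow> 'n tree_vertex \<Rightarrow> 'n \<Rightarrow> int ^ 'n" where
  "gvec B d t0 t j = (THE g. homogeneous B (X_function B d t0 t j) g)"

definition g_vector ::
  "('f, 'p, 'n::finite) seed \<Rightarrow> 'n tree_vertex \<Rightarrow> 'n tree_vertex \<Rightarrow> 'n \<Rightarrow> int ^ 'n" where
  "g_vector S t0 t j = gvec (exch S) (degs S) t0 t j"

lemma monomial_degree_superset:
  assumes "finite A" "Poly_Mapping.keys m \<subseteq> A"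
  shows "monomial_degree B m = (\<Sum>v\<in>A. Poly_Mapping.lookup m v *s var_degree B v)"
  unfolding monomial_degree_def
  by (rule sum.mono_neutral_left) (use assms in \<open>auto simp: in_keys_iff\<close>)

lemma monomial_degree_add:
  "monomial_degree B (m + m') = monomial_degree B m + monomial_degree B m'"
proof -
  let ?A = "Poly_Mapping.keys m \<union> Poly_Mapping.keys m'"
  have "Poly_Mapping.keys (m + m') \<subseteq> ?A" by (rule keys_add)
  then show ?thesis
    by (simp add: monomial_degree_superset[of ?A] lookup_add vector_sadd_rdistrib sum.distrib)
qed

lemma laurent_homogeneous_mult:
  assumes "laurent_homogeneous B p a" "laurent_homogeneous B q b"
  shows "laurent_homogeneous B (p * q) (a + b)"
  using keys_mult[of p q] assms
  unfolding laurent_homogeneous_def by (force simp: monomial_degree_add)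

lemma laurent_homogeneous_cancel:
  assumes pq: "laurent_homogeneous B (p * q) a" and q: "laurent_homogeneous B q b" "q \<noteq> 0"
  shows "laurent_homogeneous B p (a - b)"
proof -
  define bad where "bad m \<longleftrightarrow> monomial_degree B m \<noteq> a - b" for m
  have fin: "finite {m. Poly_Mapping.lookup p m \<noteq> 0}" by simp
  define p1 where "p1 = Abs_poly_mapping (\<lambda>m. Poly_Mapping.lookup p m when bad m)"
  define p0 where "p0 = p - p1"
  have l1: "Poly_Mapping.lookup p1 m = (Poly_Mapping.lookup p m when bad m)" for m
    unfolding p1_def by (subst lookup_Abs_poly_mapping) (auto intro: finite_subset[OF _ fin])
  have "laurent_homogeneous B p0 (a - b)"
    unfolding laurent_homogeneous_def p0_def
    by (auto simp: in_keys_iff lookup_minus l1 bad_def when_def split: if_splits)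
  then have h0: "laurent_homogeneous B (p0 * q) a"
    using laurent_homogeneous_mult[OF _ q(1)] by fastforce
  have p1q: "p1 * q = p * q - p0 * q" by (simp add: p0_def algebra_simps)
  have "Poly_Mapping.keys (p1 * q) = {}"
  proof (rule ccontr)
    assume "Poly_Mapping.keys (p1 * q) \<noteq> {}"
    then obtain m where m: "m \<in> Poly_Mapping.keys (p1 * q)" by blast
    then have "m \<in> Poly_Mapping.keys (p * q) \<or> m \<in> Poly_Mapping.keys (p0 * q)"
      unfolding p1q by (auto simp: in_keys_iff lookup_minus)
    then have deg: "monomial_degree B m = a"
      using pq h0 by (auto simp: laurent_homogeneous_def)
    obtain u v where uv: "m = u + v" "u \<in> Poly_Mapping.keys p1" "v \<in> Poly_Mapping.keys q"
      using m keys_mult[of p1 q] by blast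
    then have "bad u" by (auto simp: in_keys_iff l1 when_def split: if_splits)
    moreover have "monomial_degree B v = b" using uv q by (auto simp: laurent_homogeneous_def)
    ultimately show False using deg by (auto simp: uv(1) monomial_degree_add bad_def)
  qed
  then have "p1 * q = 0" by simp
  then have "p1 = 0" using q(2) by simp
  then have "p0 = p" by (simp add: p0_def)
  with \<open>laurent_homogeneous B p0 (a - b)\<close> show ?thesis by simp
qed

lemma homogeneous_laurent_iff:
  fixes p :: "'n::finite laurent"
  shows "homogeneous B (Fract p 1) g \<longleftrightarrow> p \<noteq> 0 \<and> laurent_homogeneous B p g"
proof
  assume "homogeneous B (Fract p 1) g"
  then obtain r q a b where *: "r \<noteq> 0" "q \<noteq> 0" "laurent_homogeneous B r a"
    "laurent_homogeneous B q b" "Fract p 1 = Fract r q" "g = a - b"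
    unfolding homogeneous_def by blast
  then have "p * q = r" by (simp add: eq_fract)
  then show "p \<noteq> 0 \<and> laurent_homogeneous B p g"
    using * laurent_homogeneous_cancel[of B p q a b] by auto
next
  assume p: "p \<noteq> 0 \<and> laurent_homogeneous B p g"
  have "laurent_homogeneous B (1 :: 'n laurent) 0"
    by (auto simp: laurent_homogeneous_def monomial_degree_def)
  with p show "homogeneous B (Fract p 1) g"
    unfolding homogeneous_def by (metis diff_zero one_neq_zero)
qed


section \<open>Companion seeds\<close>

definition degree_matrix :: "('f, 'p, 'n::finite) seed \<Rightarrow> int ^ 'n ^ 'n" where
  "degree_matrix S = (\<chi> i j. if i = j then int (degs S i) else 0)"

definition ordinary_seed ::
  "('n \<Rightarrow> 'f) \<Rightarrow> ('n \<Rightarrow> 'p::semifield) \<Rightarrow> int ^ 'n ^ 'n \<Rightarrow> ('f, 'p, 'n::finite) seed" where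
  "ordinary_seed x y B = \<lparr> cluster = x, coeffs = y, exch = B, polys = (\<lambda>_. [1, 1]) \<rparr>"

definition field_embedding :: "('f::field \<Rightarrow> 'g::field) \<Rightarrow> bool" where
  "field_embedding \<epsilon> \<longleftrightarrow> \<epsilon> 1 = 1 \<and>
     (\<forall>a b. \<epsilon> (a + b) = \<epsilon> a + \<epsilon> b) \<and> (\<forall>a b. \<epsilon> (a * b) = \<epsilon> a * \<epsilon> b)"

text \<open>
  The cluster variables \<open>x\<^sub>i\<^bsup>1/d\<^sub>i\<^esup>\<close> of the left companion live in an extension field of the field
  containing the \<open>x\<^sub>i\<close>; \<open>w i\<close> is the chosen root.
\<close>

definition are_cluster_roots ::
  "('f::field \<Rightarrow> 'g::field) \<Rightarrow> ('f, 'p, 'n::finite) seed \<Rightarrow> ('n \<Rightarrow> 'g) \<Rightarrow> bool" where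
  "are_cluster_roots \<epsilon> S w \<longleftrightarrow> (\<forall>i. w i ^ degs S i = \<epsilon> (cluster S i))"

definition left_companion ::
  "('n \<Rightarrow> 'g) \<Rightarrow> ('f, 'p::semifield, 'n::finite) seed \<Rightarrow> ('g, 'p, 'n) seed" where
  "left_companion w S = ordinary_seed w (coeffs S) (degree_matrix S ** exch S)"

definition right_companion ::
  "('f, 'p::semifield, 'n::finite) seed \<Rightarrow> ('f, 'p, 'n) seed" where
  "right_companion S =
     ordinary_seed (cluster S) (\<lambda>i. coeffs S i ^ degs S i) (exch S ** degree_matrix S)"

end

theory Submission
  imports Defs
begin

text \<open>
  Taking degrees in the exchange relation, and using that every \<open>\<hat>y\<^sub>k\<close> has degree zero, gives
  \<open>g'\<^sub>k = - g\<^sub>k + d\<^sub>k \<Sum>\<^sub>l [-b\<^sub>l\<^sub>k]\<^sub>+ g\<^sub>l - d\<^sub>k \<Sum>\<^sub>l [-c\<^sub>l\<^sub>k]\<^sub>+ b\<^sub>l\<close>, where \<open>b\<^sub>l\<close> is the \<open>l\<close>-th column of the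
  initial matrix and \<open>c\<^sub>l\<^sub>k\<close> is the exponent of \<open>y\<^sub>l\<close> in the \<open>k\<close>-th coefficient. Together with the
  mutation rules for \<open>b\<close> and \<open>c\<close> this recurrence determines the g-vectors without recourse to sign
  coherence. It is carried to the recurrence of the right companion by
  \<open>(B, C, G) \<mapsto> (BD, D\<^sup>-\<^sup>1CD, G)\<close>, and to that of the left companion by
  \<open>(B, C, G) \<mapsto> (DB, C, DGD\<^sup>-\<^sup>1)\<close>.
\<close>

section \<open>Cluster patterns as iterated mutations\<close>

text \<open>A pattern is a definite description, so existence and uniqueness both have to be shown.
  The walk from \<open>t0\<close> to \<open>t\<close> passes through the empty word: the letters of
  \<open>t0\<close> are undone from last to first, then those of \<open>t\<close> are applied.
  Backtracking is harmless because mutation is an involution on the class \<open>I\<close>.\<close>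

lemma pattern_from_eq_fold:
  fixes \<iota> :: "'p::semifield \<Rightarrow> 'f::field" and S :: "('f, 'p, 'n::finite) seed"
  assumes I: "I S" and closed: "\<And>T k. I T \<Longrightarrow> I (mutate \<iota> k T)"
    and invol: "\<And>T k. I T \<Longrightarrow> mutate \<iota> k (mutate \<iota> k T) = T"
  shows "pattern_from \<iota> t0 S t = fold (mutate \<iota>) (rev (word_of t0) @ word_of t) S"
proof -
  have I_fold: "I T \<Longrightarrow> I (fold (mutate \<iota>) w T)" for w T
    by (induction w arbitrary: T) (auto intro: closed)
  have retrace: "I T \<Longrightarrow> fold (mutate \<iota>) w (fold (mutate \<iota>) (rev w) T) = T" for w T
  proof (induction w)
    case (Cons a w)
    then show ?case using invol[OF I_fold[OF Cons.prems, of "rev w"], of a] by simp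
  qed simp
  define P where "P s = fold (mutate \<iota>) (rev (word_of t0) @ word_of s) S" for s :: "'n tree_vertex"
  have P_snoc: "P s' = mutate \<iota> k (P s)" if "word_of s' = word_of s @ [k]"
    for s s' :: "'n tree_vertex" and k
    using that by (simp add: P_def)
  have I_P: "I (P s)" for s unfolding P_def by (rule I_fold[OF I])
  \<comment> \<open>Towards the longer word an edge is one more step of the fold; in the other
    direction involutivity undoes that step.\<close>
  have "cluster_pattern \<iota> P"
    unfolding cluster_pattern_def tree_edge_def
  proof (intro allI impI, elim disjE)
    fix k and s s' :: "'n tree_vertex" assume "word_of s = word_of s' @ [k]"
    then show "P s' = mutate \<iota> k (P s)"
      using P_snoc[of s s' k] invol[OF I_P[of s'], of k] by simp
  qed (rule P_snoc)
  moreover have "P t0 = S" using retrace[OF I] by (simp add: P_def)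
  moreover have "Q = P" if Q: "cluster_pattern \<iota> Q" "Q t0 = S" for Q
  proof -
    let ?r = "vertex_of []"
    have r: "word_of ?r = []" by (simp add: vertex_of_inverse)
    have Q_edge: "tree_edge k s s' \<Longrightarrow> Q s' = mutate \<iota> k (Q s)" for k s s'
      using Q(1) unfolding cluster_pattern_def by blast
    \<comment> \<open>Both directions are needed: the way back from \<open>t0\<close> fixes the
      value at the root, the way out then fixes it at every vertex.\<close>
    have walk: "distinct_adj w \<Longrightarrow> Q (vertex_of w) = fold (mutate \<iota>) w (Q ?r) \<and>
        Q ?r = fold (mutate \<iota>) (rev w) (Q (vertex_of w))" for w
    proof (induction w rule: rev_induct)
      case (snoc k w)
      then have w: "distinct_adj w" by (metis distinct_adj_appendD1)
      have "tree_edge k (vertex_of w) (vertex_of (w @ [k]))"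
        "tree_edge k (vertex_of (w @ [k])) (vertex_of w)"
        using snoc.prems w by (simp_all add: tree_edge_def vertex_of_inverse)
      note e = this[THEN Q_edge]
      have i1: "Q (vertex_of w) = fold (mutate \<iota>) w (Q ?r)"
        and i2: "Q ?r = fold (mutate \<iota>) (rev w) (Q (vertex_of w))"
        using snoc.IH[OF w] by blast+
      have "Q (vertex_of (w @ [k])) = fold (mutate \<iota>) (w @ [k]) (Q ?r)"
        by (simp add: e(1) i1)
      moreover have "Q ?r = fold (mutate \<iota>) (rev (w @ [k])) (Q (vertex_of (w @ [k])))"
        by (subst i2, subst e(2)) simp
      ultimately show ?case ..
    qed simp
    have "distinct_adj (word_of s)" for s :: "'n tree_vertex" using word_of[of s] by simp
    note walk' = walk[OF this, unfolded word_of_inverse]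
    have "Q s = P s" for s
      by (simp add: P_def conjunct1[OF walk', of s] conjunct2[OF walk', of t0, unfolded Q(2)])
    then show ?thesis by (rule ext)
  qed
  ultimately have "pattern_from \<iota> t0 S = P"
    unfolding pattern_from_def by (blast intro: the_equality)
  then show ?thesis by (simp add: P_def)
qed


section \<open>Positive homogeneous rational functions\<close>

definition nonneg :: "('a \<Rightarrow>\<^sub>0 int) \<Rightarrow> bool" where
  "nonneg p \<longleftrightarrow> (\<forall>m. 0 \<le> Poly_Mapping.lookup p m)"

lemma nonneg_add: "nonneg p \<Longrightarrow> nonneg q \<Longrightarrow> nonneg (p + q)"
  by (simp add: nonneg_def lookup_add)

lemma nonneg_mult:
  fixes p q :: "'a::monoid_add \<Rightarrow>\<^sub>0 int"
  shows "nonneg p \<Longrightarrow> nonneg q \<Longrightarrow> nonneg (p * q)"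
  unfolding nonneg_def lookup_mult Sum_any.expand_set
  by (intro allI sum_nonneg mult_nonneg_nonneg) (simp_all add: when_def)

lemma nonneg_add_nonzero:
  assumes "nonneg p" "nonneg q" "p \<noteq> 0"
  shows "p + q \<noteq> 0"
proof
  assume "p + q = 0"
  have "Poly_Mapping.lookup p m = 0" for m
  proof -
    have "Poly_Mapping.lookup p m + Poly_Mapping.lookup q m = 0"
      using \<open>p + q = 0\<close> by (metis lookup_add lookup_zero)
    moreover have "0 \<le> Poly_Mapping.lookup p m" "0 \<le> Poly_Mapping.lookup q m"
      using assms by (auto simp: nonneg_def)
    ultimately show ?thesis by linarith
  qed
  then show False using \<open>p \<noteq> 0\<close> by (metis lookup_zero poly_mapping_eqI)
qed

text \<open>
  Positivity is what makes this class closed under addition within a fixed degree: no sum of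
  such functions can vanish.
\<close>

definition pos_homogeneous :: "int ^ 'n ^ 'n \<Rightarrow> 'n::finite ratfun \<Rightarrow> int ^ 'n \<Rightarrow> bool" where
  "pos_homogeneous B f g \<longleftrightarrow>
     (\<exists>p q a b. p \<noteq> 0 \<and> q \<noteq> 0 \<and> nonneg p \<and> nonneg q \<and>
        laurent_homogeneous B p a \<and> laurent_homogeneous B q b \<and> f = Fract p q \<and> g = a - b)"

lemma pos_homogeneous_imp_homogeneous: "pos_homogeneous B f g \<Longrightarrow> homogeneous B f g"
  unfolding pos_homogeneous_def homogeneous_def by blast

lemma pos_homogeneous_nonzero: "pos_homogeneous B f g \<Longrightarrow> f \<noteq> 0"
  unfolding pos_homogeneous_def by (auto simp: Zero_fract_def eq_fract)

lemma pos_homogeneous_one: "pos_homogeneous B 1 0"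
  unfolding pos_homogeneous_def
proof (intro exI conjI)
  show "1 = Fract 1 (1 :: 'a laurent)" by (simp add: One_fract_def)
  show "nonneg (1 :: 'a laurent)" "nonneg (1 :: 'a laurent)"
    by (simp_all add: nonneg_def lookup_one when_def)
  show "laurent_homogeneous B (1 :: 'a laurent) 0" "laurent_homogeneous B (1 :: 'a laurent) 0"
    by (auto simp: laurent_homogeneous_def monomial_degree_def)
qed auto

lemma pos_homogeneous_mult:
  assumes "pos_homogeneous B f g" "pos_homogeneous B f' g'"
  shows "pos_homogeneous B (f * f') (g + g')"
proof -
  obtain p q a b where f: "p \<noteq> 0" "q \<noteq> 0" "nonneg p" "nonneg q" "laurent_homogeneous B p a"
    "laurent_homogeneous B q b" "f = Fract p q" "g = a - b"
    using assms(1) unfolding pos_homogeneous_def by blast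
  obtain p' q' a' b' where f': "p' \<noteq> 0" "q' \<noteq> 0" "nonneg p'" "nonneg q'"
    "laurent_homogeneous B p' a'" "laurent_homogeneous B q' b'" "f' = Fract p' q'" "g' = a' - b'"
    using assms(2) unfolding pos_homogeneous_def by blast
  show ?thesis unfolding pos_homogeneous_def
    by (rule exI[of _ "p * p'"], rule exI[of _ "q * q'"], rule exI[of _ "a + a'"],
        rule exI[of _ "b + b'"])
      (use f f' in \<open>auto intro: nonneg_mult laurent_homogeneous_mult\<close>)
qed

lemma pos_homogeneous_inverse:
  assumes "pos_homogeneous B f g"
  shows "pos_homogeneous B (inverse f) (- g)"
proof -
  obtain p q a b where f: "p \<noteq> 0" "q \<noteq> 0" "nonneg p" "nonneg q" "laurent_homogeneous B p a"
    "laurent_homogeneous B q b" "f = Fract p q" "g = a - b"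
    using assms(1) unfolding pos_homogeneous_def by blast
  show ?thesis unfolding pos_homogeneous_def
    by (rule exI[of _ q], rule exI[of _ p], rule exI[of _ b], rule exI[of _ a]) (use f in auto)
qed

lemma pos_homogeneous_divide:
  "pos_homogeneous B f g \<Longrightarrow> pos_homogeneous B f' g' \<Longrightarrow> pos_homogeneous B (f / f') (g - g')"
  using pos_homogeneous_mult[OF _ pos_homogeneous_inverse] by (simp add: divide_inverse)

lemma pos_homogeneous_add:
  assumes "pos_homogeneous B f g" "pos_homogeneous B f' g"
  shows "pos_homogeneous B (f + f') g"
proof -
  obtain p q a b where f: "p \<noteq> 0" "q \<noteq> 0" "nonneg p" "nonneg q" "laurent_homogeneous B p a"
    "laurent_homogeneous B q b" "f = Fract p q" "g = a - b"
    using assms(1) unfolding pos_homogeneous_def by blast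
  obtain p' q' a' b' where f': "p' \<noteq> 0" "q' \<noteq> 0" "nonneg p'" "nonneg q'"
    "laurent_homogeneous B p' a'" "laurent_homogeneous B q' b'" "f' = Fract p' q'" "g = a' - b'"
    using assms(2) unfolding pos_homogeneous_def by blast
  \<comment> \<open>The quotients have equal degree, so both terms of the numerator over the common
    denominator have degree \<open>a + b'\<close>.\<close>
  have "a' + b = a + b'" using f(8) f'(8) by (simp add: algebra_simps)
  then have "laurent_homogeneous B (p * q') (a + b')" "laurent_homogeneous B (p' * q) (a + b')"
    using laurent_homogeneous_mult[OF f(5) f'(6)] laurent_homogeneous_mult[OF f'(5) f(6)] by auto
  then have "laurent_homogeneous B (p * q' + p' * q) (a + b')"
    using keys_add[of "p * q'" "p' * q"] unfolding laurent_homogeneous_def by blast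
  moreover have "laurent_homogeneous B (q * q') (b + b')"
    using f f' by (auto intro: laurent_homogeneous_mult)
  moreover have "nonneg (p * q')" "nonneg (p' * q)" "nonneg (q * q')"
    using f f' by (auto intro: nonneg_mult)
  moreover have "p * q' \<noteq> 0" "q * q' \<noteq> 0" using f f' by auto
  moreover have "f + f' = Fract (p * q' + p' * q) (q * q')" "g = (a + b') - (b + b')"
    using f f' by auto
  ultimately show ?thesis unfolding pos_homogeneous_def
    using nonneg_add nonneg_add_nonzero by blast
qed

lemma pos_homogeneous_power:
  "pos_homogeneous B f g \<Longrightarrow> pos_homogeneous B (f ^ n) (int n *s g)"
proof (induction n)
  case (Suc n)
  then show ?case using pos_homogeneous_mult[of B f g "f ^ n" "int n *s g"]
    by (simp add: vector_sadd_rdistrib)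
qed (simp add: pos_homogeneous_one)

lemma pos_homogeneous_powi:
  assumes "pos_homogeneous B f g"
  shows "pos_homogeneous B (f powi n) (n *s g)"
proof (cases "n \<ge> 0")
  case True
  then show ?thesis using pos_homogeneous_power[OF assms, of "nat n"] by (simp add: power_int_def)
next
  case False
  then show ?thesis using pos_homogeneous_power[OF pos_homogeneous_inverse[OF assms], of "nat (- n)"]
    by (simp add: power_int_def vector_smult_lneg)
qed

lemma pos_homogeneous_prod:
  assumes "\<And>a. a \<in> A \<Longrightarrow> pos_homogeneous B (f a) (g a)"
  shows "pos_homogeneous B (\<Prod>a\<in>A. f a) (\<Sum>a\<in>A. g a)"
  using assms
  by (induction A rule: infinite_finite_induct)
    (auto simp: pos_homogeneous_one intro: pos_homogeneous_mult)

text \<open>Nonemptiness matters: the empty sum is zero, which is not positive homogeneous of any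
  degree.\<close>

lemma pos_homogeneous_sum:
  assumes "finite A" "A \<noteq> {}" "\<And>a. a \<in> A \<Longrightarrow> pos_homogeneous B (f a) g"
  shows "pos_homogeneous B (\<Sum>a\<in>A. f a) g"
  using assms by (induction A rule: finite_ne_induct) (auto intro: pos_homogeneous_add)

text \<open>After cross-multiplication the same nonzero Laurent polynomial has two degrees, and any
  of its monomials forces them to agree. This justifies the definite description in
  \<open>gvec\<close>.\<close>

lemma homogeneous_unique:
  assumes "homogeneous B f g" "homogeneous B f g'"
  shows "g = g'"
proof -
  obtain p q a b where f: "p \<noteq> 0" "q \<noteq> 0" "laurent_homogeneous B p a"
    "laurent_homogeneous B q b" "f = Fract p q" "g = a - b"
    using assms(1) unfolding homogeneous_def by blast
  obtain p' q' a' b' where f': "p' \<noteq> 0" "q' \<noteq> 0"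
    "laurent_homogeneous B p' a'" "laurent_homogeneous B q' b'" "f = Fract p' q'" "g' = a' - b'"
    using assms(2) unfolding homogeneous_def by blast
  have eq: "p * q' = p' * q" using f f' by (simp add: eq_fract)
  have "p * q' \<noteq> 0" using f f' by simp
  then have "Poly_Mapping.keys (p * q') \<noteq> {}" by simp
  then obtain m where m: "m \<in> Poly_Mapping.keys (p * q')" by blast
  have "laurent_homogeneous B (p * q') (a + b')" "laurent_homogeneous B (p * q') (a' + b)"
    using laurent_homogeneous_mult[OF f(3) f'(4)] laurent_homogeneous_mult[OF f'(3) f(4)] eq by auto
  then have "a + b' = a' + b" using m unfolding laurent_homogeneous_def by metis
  then show ?thesis by (simp add: f(6) f'(6) algebra_simps)
qed

lemma pos_homogeneous_indet: "pos_homogeneous B (indet v) (var_degree B v)"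
  unfolding pos_homogeneous_def
proof (intro exI conjI)
  let ?m = "Poly_Mapping.single v (1::int)"
  let ?p = "Poly_Mapping.single ?m 1 :: 'a laurent"
  show "indet v = Fract ?p 1" by (simp add: indet_def)
  show "?p \<noteq> 0" "(1 :: 'a laurent) \<noteq> 0" by (auto simp: single_zero)
  show "nonneg ?p" "nonneg (1 :: 'a laurent)"
    by (simp_all add: nonneg_def lookup_one lookup_single when_def)
  show "laurent_homogeneous B ?p (var_degree B v)" "laurent_homogeneous B (1 :: 'a laurent) 0"
    by (auto simp: laurent_homogeneous_def monomial_degree_def)
qed simp


section \<open>Tropical coefficients\<close>

abbreviation cexp :: "'v trop \<Rightarrow> 'v \<Rightarrow> int" where
  "cexp p \<equiv> Poly_Mapping.lookup (expo p)"

lemma trop_eqI: "(\<And>v. cexp p v = cexp q v) \<Longrightarrow> p = q"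
  by (cases p; cases q) (auto intro: poly_mapping_eqI)

lemma cexp_simps [simp]:
  "cexp 1 v = 0" "cexp (p * q) v = cexp p v + cexp q v" "cexp (inverse p) v = - cexp p v"
  by (simp_all add: one_trop_def times_trop_def inverse_trop_def lookup_add)

lemma cexp_add [simp]: "cexp (p \<oplus> q) v = min (cexp p v) (cexp q v)"
  by (simp add: semifield_add_trop_def pointwise_min.rep_eq)

lemma cexp_power [simp]: "cexp (p ^ n) v = int n * cexp p v"
  by (induction n) (simp_all add: algebra_simps)

lemma cexp_powi [simp]: "cexp (p powi n) v = n * cexp p v"
  by (simp add: power_int_def)

lemma cexp_trop_gen: "cexp (trop_gen u) v = (if u = v then 1 else 0)"
  by (simp add: trop_gen_def lookup_single when_def)

lemma cexp_semifield_sum: "ps \<noteq> [] \<Longrightarrow> cexp (semifield_sum ps) v = Min ((\<lambda>p. cexp p v) ` set ps)"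
  by (induction ps rule: semifield_sum.induct) auto

lemma cexp_eval_semifield:
  assumes "z \<noteq> []"
  shows "cexp (eval_semifield z y) v = Min ((\<lambda>s. cexp (z ! s) v + int s * cexp y v) ` {..<length z})"
proof -
  have "(\<lambda>p. cexp p v) ` set (map (\<lambda>s. z ! s * y ^ s) [0..<length z])
      = (\<lambda>s. cexp (z ! s) v + int s * cexp y v) ` {..<length z}"
    by (auto simp: image_image atLeast0LessThan)
  then show ?thesis using assms unfolding eval_semifield_def by (subst cexp_semifield_sum) auto
qed

text \<open>Tropical form of \<open>Z'(1/y) = y^(-d) Z(y)\<close>: the term with index
  \<open>s\<close> on the left is the term with index \<open>d - s\<close> on the right, shifted by
  the exponent of \<open>y^(-d)\<close>.\<close>

lemma eval_semifield_rev:
  fixes y :: "'v trop"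
  assumes "z \<noteq> []"
  shows "eval_semifield (rev z) (inverse y) = inverse (y ^ (length z - 1)) * eval_semifield z y"
proof (rule trop_eqI)
  fix v
  let ?d = "length z - 1"
  let ?f = "\<lambda>s. cexp (z ! s) v + int s * cexp y v"
  have "cexp (rev z ! s) v + int s * cexp (inverse y) v = - (int ?d * cexp y v) + ?f (?d - s)"
    if "s < length z" for s
    using that by (simp add: rev_nth of_nat_diff algebra_simps)
  then have "(\<lambda>s. cexp (rev z ! s) v + int s * cexp (inverse y) v) ` {..<length z}
      = (\<lambda>s. - (int ?d * cexp y v) + ?f (?d - s)) ` {..<length z}"
    by (intro image_cong) auto
  also have "\<dots> = (\<lambda>a. - (int ?d * cexp y v) + a) ` ?f ` (\<lambda>s. ?d - s) ` {..<length z}"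
    by (simp add: image_image)
  also have "(\<lambda>s. ?d - s) ` {..<length z} = {..<length z}"
  proof (intro equalityI subsetI)
    fix s assume "s \<in> {..<length z}"
    then have "s = ?d - (?d - s)" "?d - s \<in> {..<length z}" by auto
    then show "s \<in> (\<lambda>s. ?d - s) ` {..<length z}" by blast
  qed auto
  also have "Min ((\<lambda>a. - (int ?d * cexp y v) + a) ` ?f ` {..<length z})
      = - (int ?d * cexp y v) + Min (?f ` {..<length z})"
    using assms by (subst mono_Min_commute[symmetric]) (auto intro!: monoI)
  finally show "cexp (eval_semifield (rev z) (inverse y)) v
      = cexp (inverse (y ^ ?d) * eval_semifield z y) v"
    using assms by (simp add: cexp_eval_semifield)
qed

text \<open>The extreme terms \<open>s = 0\<close> and \<open>s = d\<close> attain the minimum.\<close>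

lemma cexp_eval_semifield_const:
  assumes "z \<noteq> []" "\<And>p. p \<in> set z \<Longrightarrow> cexp p v = 0"
  shows "cexp (eval_semifield z y) v = - (int (length z - 1) * max (- cexp y v) 0)"
proof -
  let ?d = "length z - 1"
  have "(\<lambda>s. cexp (z ! s) v + int s * cexp y v) ` {..<length z} = (\<lambda>s. int s * cexp y v) ` {..<length z}"
    using assms(2) by (intro image_cong) auto
  moreover have "Min ((\<lambda>s. int s * cexp y v) ` {..<length z}) = - (int ?d * max (- cexp y v) 0)"
  proof (rule Min_eqI)
    fix a assume "a \<in> (\<lambda>s. int s * cexp y v) ` {..<length z}"
    then obtain s where "s < length z" "a = int s * cexp y v" by blast
    then have s: "s \<le> ?d" "a = int s * cexp y v" by auto
    have "- (int ?d * max (- cexp y v) 0) \<le> - (int s * max (- cexp y v) 0)"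
      using s(1) by (simp add: mult_right_mono)
    also have "\<dots> \<le> a"
      unfolding s(2) by (auto simp: max_def)
    finally show "- (int ?d * max (- cexp y v) 0) \<le> a" .
  next
    have "- (int ?d * max (- cexp y v) 0) = int (if cexp y v \<ge> 0 then 0 else ?d) * cexp y v"
      by (simp add: max_def)
    moreover have "(if cexp y v \<ge> 0 then 0 else ?d) \<in> {..<length z}" using assms(1) by simp
    ultimately show "- (int ?d * max (- cexp y v) 0) \<in> (\<lambda>s. int s * cexp y v) ` {..<length z}"
      by (rule image_eqI)
  qed simp
  ultimately show ?thesis using assms(1) by (simp add: cexp_eval_semifield)
qed

section \<open>The embedding of tropical coefficients and their degrees\<close>

lemma trop_to_ratfun_superset:
  assumes "finite A" "Poly_Mapping.keys (expo p) \<subseteq> A"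
  shows "trop_to_ratfun p = (\<Prod>c\<in>A. indet (Coef c) powi cexp p c)"
  unfolding trop_to_ratfun_def
  by (rule prod.mono_neutral_left) (use assms in \<open>auto simp: in_keys_iff\<close>)

lemma trop_to_ratfun_mult: "trop_to_ratfun (p * q) = trop_to_ratfun p * trop_to_ratfun q"
proof -
  let ?A = "Poly_Mapping.keys (expo p) \<union> Poly_Mapping.keys (expo q)"
  have "Poly_Mapping.keys (expo (p * q)) \<subseteq> ?A"
    by (simp add: times_trop_def keys_add)
  then show ?thesis
    by (simp add: trop_to_ratfun_superset[of ?A] prod.distrib[symmetric] power_int_add
        pos_homogeneous_nonzero[OF pos_homogeneous_indet])
qed

lemma trop_to_ratfun_one: "trop_to_ratfun 1 = 1"
  by (simp add: trop_to_ratfun_def one_trop_def)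

text \<open>In matrix terms this is minus \<open>B\<close> times the vector of
  \<open>Y\<close>-exponents. The sign comes from the degree of \<open>Y j\<close>, and the
  \<open>Z\<close>-variables have degree zero.\<close>

definition trop_degree :: "int ^ 'n ^ 'n \<Rightarrow> 'n::finite coef_var trop \<Rightarrow> int ^ 'n" where
  "trop_degree B p = (\<chi> i. - (\<Sum>j\<in>UNIV. cexp p (Y j) * B $ i $ j))"

lemma pos_homogeneous_trop: "pos_homogeneous B (trop_to_ratfun p) (trop_degree B p)"
proof -
  let ?A = "Poly_Mapping.keys (expo p) \<union> range Y"
  let ?g = "\<lambda>c. cexp p c *s var_degree B (Coef c)"
  have "pos_homogeneous B (trop_to_ratfun p) (\<Sum>c\<in>?A. ?g c)"
    by (subst trop_to_ratfun_superset[of ?A])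
      (auto intro!: pos_homogeneous_prod pos_homogeneous_powi pos_homogeneous_indet)
  also have "(\<Sum>c\<in>?A. ?g c) = (\<Sum>c\<in>range Y. ?g c)"
  proof (rule sum.mono_neutral_right)
    show "\<forall>c\<in>?A - range Y. ?g c = 0"
    proof
      fix c assume "c \<in> ?A - range Y"
      then show "?g c = 0" by (cases c) auto
    qed
  qed auto
  also have "\<dots> = (\<Sum>j\<in>UNIV. ?g (Y j))"
    by (subst sum.reindex) (auto simp: inj_on_def)
  also have "\<dots> = trop_degree B p"
    by (simp add: vec_eq_iff trop_degree_def column_def sum_negf)
  finally show ?thesis .
qed


section \<open>The recurrence for exchange matrices, c-vectors and g-vectors\<close>

text \<open>The columns of \<open>cmat\<close> are the c-vectors, the exponents of the \<open>y\<^sub>i\<close> in the coefficients.\<close>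

record 'n cg_data =
  bmat :: "'n \<Rightarrow> 'n \<Rightarrow> int"
  cmat :: "'n \<Rightarrow> 'n \<Rightarrow> int"
  gmat :: "'n \<Rightarrow> 'n \<Rightarrow> int"

definition cg_initial :: "int ^ 'n ^ 'n \<Rightarrow> 'n::finite cg_data" where
  "cg_initial B =
     \<lparr> bmat = (\<lambda>i j. B $ i $ j), cmat = (\<lambda>i j. of_bool (i = j)), gmat = (\<lambda>i j. of_bool (i = j)) \<rparr>"

text \<open>The parameter \<open>B\<close> is the initial matrix and stays fixed; the current one is
  \<open>bmat\<close>. The term with \<open>[- c i k]\<^sub>+\<close> in \<open>cmat\<close> comes
  from the tropical value of the exchange polynomial, whose exponent of \<open>Y i\<close> is
  \<open>- e * [- c i k]\<^sub>+\<close>.\<close>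

definition cg_mutate ::
  "int ^ 'n ^ 'n \<Rightarrow> ('n::finite \<Rightarrow> nat) \<Rightarrow> 'n \<Rightarrow> 'n cg_data \<Rightarrow> 'n cg_data" where
  "cg_mutate B d k N =
    (let b = bmat N; c = cmat N; g = gmat N; e = int (d k)
     in \<lparr> bmat = (\<lambda>i j. if i = k \<or> j = k then - b i j
            else b i j + [b i k]\<^sub>+ * e * b k j + b i k * e * [- b k j]\<^sub>+),
          cmat = (\<lambda>i j. if j = k then - c i k
            else c i j + e * c i k * [b k j]\<^sub>+ + e * [- c i k]\<^sub>+ * b k j),
          gmat = (\<lambda>i j. if j = k
            then - g i k + e * (\<Sum>l\<in>UNIV. [- b l k]\<^sub>+ * g i l) - e * (\<Sum>l\<in>UNIV. B $ i $ l * [- c l k]\<^sub>+)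
            else g i j) \<rparr>)"

lemma cg_mutate_sel:
  "bmat (cg_mutate B d k N) i j = (if i = k \<or> j = k then - bmat N i j
     else bmat N i j + [bmat N i k]\<^sub>+ * int (d k) * bmat N k j
       + bmat N i k * int (d k) * [- bmat N k j]\<^sub>+)"
  "cmat (cg_mutate B d k N) i j = (if j = k then - cmat N i k
     else cmat N i j + int (d k) * cmat N i k * [bmat N k j]\<^sub>+
       + int (d k) * [- cmat N i k]\<^sub>+ * bmat N k j)"
  "gmat (cg_mutate B d k N) i j = (if j = k
     then - gmat N i k + int (d k) * (\<Sum>l\<in>UNIV. [- bmat N l k]\<^sub>+ * gmat N i l)
       - int (d k) * (\<Sum>l\<in>UNIV. B $ i $ l * [- cmat N l k]\<^sub>+)
     else gmat N i j)"
  by (simp_all add: cg_mutate_def Let_def)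

lemma pos_part_mult: "0 \<le> a \<Longrightarrow> [a * b]\<^sub>+ = a * [b]\<^sub>+"
  by (auto simp: max_def mult_le_0_iff zero_le_mult_iff)

section \<open>Skew-symmetrizability and duality under the recurrence\<close>

definition skew_data :: "('n \<Rightarrow> int) \<Rightarrow> 'n cg_data \<Rightarrow> bool" where
  "skew_data r N \<longleftrightarrow>
     (\<forall>i. r i > 0) \<and> (\<forall>i j. r i * bmat N i j = - (r j * bmat N j i))"

lemma skew_data_diagonal:
  assumes "skew_data r N"
  shows "bmat N k k = 0"
proof -
  have "r k > 0" "r k * bmat N k k = - (r k * bmat N k k)"
    using assms unfolding skew_data_def by blast+
  then show ?thesis by simp
qed

text \<open>Multiplied by the symmetrizer, the two correction terms of an entry become, up to sign
  and in exchanged order, those of the transposed entry. Hence one \<open>r\<close> serves along the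
  whole recurrence.\<close>

lemma skew_data_mutate:
  assumes "skew_data r N"
  shows "skew_data r (cg_mutate B d k N)"
proof -
  have r: "r i > 0" and skew: "r i * bmat N i j = - (r j * bmat N j i)" for i j
    using assms unfolding skew_data_def by blast+
  have "r i * bmat (cg_mutate B d k N) i j = - (r j * bmat (cg_mutate B d k N) j i)" for i j
  proof (cases "i = k \<or> j = k")
    case True
    then show ?thesis using skew[of i j] by (auto simp: cg_mutate_sel)
  next
    case False
    have jk: "r j * [bmat N j k]\<^sub>+ = r k * [- bmat N k j]\<^sub>+"
      using skew[of j k] r[of j] r[of k] pos_part_mult[of "r j" "bmat N j k"]
        pos_part_mult[of "r k" "- bmat N k j"] by simp
    have ki: "r k * [- bmat N k i]\<^sub>+ = r i * [bmat N i k]\<^sub>+"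
      using skew[of i k] r[of i] r[of k] pos_part_mult[of "r i" "bmat N i k"]
        pos_part_mult[of "r k" "- bmat N k i"] by simp
    have "r j * ([bmat N j k]\<^sub>+ * bmat N k i + bmat N j k * [- bmat N k i]\<^sub>+)
        = (r j * [bmat N j k]\<^sub>+) * bmat N k i + (r j * bmat N j k) * [- bmat N k i]\<^sub>+"
      by (simp add: algebra_simps)
    also have "\<dots> = [- bmat N k j]\<^sub>+ * (r k * bmat N k i) - bmat N k j * (r k * [- bmat N k i]\<^sub>+)"
      by (simp add: jk skew[of j k])
    also have "\<dots> = - (r i * ([bmat N i k]\<^sub>+ * bmat N k j + bmat N i k * [- bmat N k j]\<^sub>+))"
      by (simp only: ki skew[of k i]) (simp add: algebra_simps)
    finally have e: "int (d k) * (r i * ([bmat N i k]\<^sub>+ * bmat N k j + bmat N i k * [- bmat N k j]\<^sub>+))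
        = - (int (d k) * (r j * ([bmat N j k]\<^sub>+ * bmat N k i + bmat N j k * [- bmat N k i]\<^sub>+)))"
      by simp
    have "r i * bmat (cg_mutate B d k N) i j = r i * bmat N i j
        + int (d k) * (r i * ([bmat N i k]\<^sub>+ * bmat N k j + bmat N i k * [- bmat N k j]\<^sub>+))"
      using False by (simp add: cg_mutate_sel distrib_left mult_ac)
    also have "\<dots> = - (r j * bmat (cg_mutate B d k N) j i)"
      unfolding e skew[of i j] using False by (simp add: cg_mutate_sel distrib_left mult_ac)
    finally show ?thesis .
  qed
  then show ?thesis using r unfolding skew_data_def by blast
qed

text \<open>The identity \<open>B C = G B\<^sup>t\<close> says that every \<open>\<hat>y\<^sub>j\<close> of the seed has degree zero.\<close>

definition dual_data :: "int ^ 'n ^ 'n \<Rightarrow> 'n::finite cg_data \<Rightarrow> bool" where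
  "dual_data B N \<longleftrightarrow>
     (\<forall>i j. (\<Sum>l\<in>UNIV. B $ i $ l * cmat N l j) = (\<Sum>l\<in>UNIV. gmat N i l * bmat N l j))"

lemma dual_data_initial: "dual_data B (cg_initial B)"
  by (simp add: dual_data_def cg_initial_def)

text \<open>For \<open>j \<noteq> k\<close> both sides become
  \<open>P j + e [b_kj]_+ P k + e b_kj Q\<close>. The term with \<open>Q\<close> comes from the
  c-vector rule on the left and from the new g-vector on the right.\<close>

lemma dual_data_mutate:
  fixes N :: "'n::finite cg_data"
  assumes dual: "dual_data B N" and kk: "bmat N k k = 0"
  shows "dual_data B (cg_mutate B d k N)"
  unfolding dual_data_def
proof (intro allI)
  fix i j
  let ?b = "bmat N" and ?c = "cmat N" and ?g = "gmat N" and ?N' = "cg_mutate B d k N"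
  let ?e = "int (d k)"
  define P where "P j = (\<Sum>l\<in>UNIV. ?g i l * ?b l j)" for j
  define Q where "Q = (\<Sum>l\<in>UNIV. B $ i $ l * [- ?c l k]\<^sub>+)"
  define R where "R = (\<Sum>l\<in>UNIV. [- ?b l k]\<^sub>+ * ?g i l)"
  define R' where "R' = (\<Sum>l\<in>UNIV. [?b l k]\<^sub>+ * ?g i l)"
  have P: "(\<Sum>l\<in>UNIV. B $ i $ l * ?c l j) = P j" for j
    using dual by (simp add: dual_data_def P_def)
  \<comment> \<open>From \<open>[b]_+ - [-b]_+ = b\<close>.\<close>
  have RR: "R' - R = P k"
    unfolding R_def R'_def P_def sum_subtractf[symmetric]
    by (intro sum.cong) (auto simp: max_def)
  have g'k: "gmat ?N' i k = - ?g i k + ?e * R - ?e * Q"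
    by (simp add: cg_mutate_sel R_def Q_def)
  show "(\<Sum>l\<in>UNIV. B $ i $ l * cmat ?N' l j) = (\<Sum>l\<in>UNIV. gmat ?N' i l * bmat ?N' l j)"
  proof (cases "j = k")
    case True
    have "(\<Sum>l\<in>UNIV. gmat ?N' i l * bmat ?N' l j) = (\<Sum>l\<in>UNIV. - (?g i l * ?b l k))"
      by (intro sum.cong) (auto simp: cg_mutate_sel True kk)
    then show ?thesis using P[of k] by (simp add: cg_mutate_sel True sum_negf P_def)
  next
    case False
    let ?F = "\<lambda>l. ?g i l * (?b l j + [?b l k]\<^sub>+ * ?e * ?b k j + ?b l k * ?e * [- ?b k j]\<^sub>+)"
    \<comment> \<open>Column \<open>k\<close> of \<open>gmat\<close> and row \<open>k\<close> of
      \<open>bmat\<close> follow rules of their own, so the index \<open>k\<close> is split off.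
      Completing the remaining sum costs \<open>?F k\<close>, which by \<open>kk\<close> equals
      \<open>?g i k * ?b k j\<close> and cancels against the split summand.\<close>
    have "(\<Sum>l\<in>UNIV. gmat ?N' i l * bmat ?N' l j)
        = gmat ?N' i k * bmat ?N' k j + (\<Sum>l\<in>UNIV - {k}. gmat ?N' i l * bmat ?N' l j)"
      by (simp add: sum.remove[of UNIV k])
    also have "(\<Sum>l\<in>UNIV - {k}. gmat ?N' i l * bmat ?N' l j) = (\<Sum>l\<in>UNIV - {k}. ?F l)"
      by (intro sum.cong) (auto simp: cg_mutate_sel False)
    also have "\<dots> = (\<Sum>l\<in>UNIV. ?F l) - ?F k"
      by (simp add: sum_diff1)
    also have "(\<Sum>l\<in>UNIV. ?F l) = P j + ?e * ?b k j * R' + ?e * [- ?b k j]\<^sub>+ * P k"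
      unfolding P_def R'_def by (simp add: distrib_left sum.distrib sum_distrib_left mult_ac)
    also have "gmat ?N' i k * bmat ?N' k j = (?g i k - ?e * R + ?e * Q) * ?b k j"
      unfolding g'k by (simp add: cg_mutate_sel algebra_simps)
    also have "R' = P k + R" using RR by simp
    finally have "(\<Sum>l\<in>UNIV. gmat ?N' i l * bmat ?N' l j)
        = P j + ?e * (?b k j + [- ?b k j]\<^sub>+) * P k + ?e * ?b k j * Q"
      by (simp add: kk algebra_simps)
    also have "?b k j + [- ?b k j]\<^sub>+ = [?b k j]\<^sub>+" by (simp add: max_def)
    also have "P j + ?e * [?b k j]\<^sub>+ * P k + ?e * ?b k j * Q = (\<Sum>l\<in>UNIV. B $ i $ l * cmat ?N' l j)"
      unfolding P[symmetric] Q_def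
      by (simp add: cg_mutate_sel False distrib_left sum.distrib sum_distrib_left mult_ac)
    finally show ?thesis by simp
  qed
qed


section \<open>The recurrence computes the g-vectors\<close>

lemma mutate_sel:
  "cluster (mutate \<iota> k S) i = (if i = k
     then (\<Prod>l\<in>UNIV. cluster S l powi [- (exch S $ l $ k)]\<^sub>+) ^ degs S k
       * (eval_field \<iota> (polys S k) (yhat \<iota> S k) / \<iota> (eval_semifield (polys S k) (coeffs S k)))
       / cluster S k
     else cluster S i)"
  "coeffs (mutate \<iota> k S) j = (if j = k then inverse (coeffs S k)
     else coeffs S j * (coeffs S k ^ degs S k) powi [exch S $ k $ j]\<^sub>+
       * eval_semifield (polys S k) (coeffs S k) powi (- (exch S $ k $ j)))"
  "exch (mutate \<iota> k S) $ i $ j = (if i = k \<or> j = k then - (exch S $ i $ j)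
     else exch S $ i $ j + [exch S $ i $ k]\<^sub>+ * int (degs S k) * exch S $ k $ j
       + exch S $ i $ k * int (degs S k) * [- (exch S $ k $ j)]\<^sub>+)"
  "polys (mutate \<iota> k S) = (polys S)(k := rev (polys S k))"
  by (simp_all add: mutate_def Let_def)

lemma degs_mutate [simp]: "degs (mutate \<iota> k S) i = degs S i"
  by (simp add: degs_def mutate_sel)

text \<open>Field counterpart of \<open>eval_semifield_rev\<close>, by the same reversal of the
  summation index.\<close>

lemma eval_field_rev:
  assumes "u \<noteq> 0" "z \<noteq> []"
  shows "eval_field \<iota> (rev z) (inverse u) = eval_field \<iota> z u / u ^ (length z - 1)"
proof -
  have "eval_field \<iota> (rev z) (inverse u)
      = (\<Sum>s<length z. \<iota> (z ! (length z - Suc s)) * inverse u ^ s)"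
    by (simp add: eval_field_def rev_nth)
  also have "\<dots> = (\<Sum>s<length z. \<iota> (z ! (length z - Suc s)) * u ^ (length z - Suc s) / u ^ (length z - 1))"
  proof (intro sum.cong refl)
    fix s assume "s \<in> {..<length z}"
    then have "length z - 1 = (length z - Suc s) + s" by auto
    then have "u ^ (length z - 1) = u ^ (length z - Suc s) * u ^ s" by (metis power_add)
    then show "\<iota> (z ! (length z - Suc s)) * inverse u ^ s
        = \<iota> (z ! (length z - Suc s)) * u ^ (length z - Suc s) / u ^ (length z - 1)"
      using assms by (simp add: field_simps)
  qed
  also have "\<dots> = (\<Sum>s<length z. \<iota> (z ! s) * u ^ s / u ^ (length z - 1))"
    by (rule sum.nat_diff_reindex)
  finally show ?thesis by (simp add: eval_field_def sum_divide_distrib)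
qed

text \<open>The invariant tying a seed to the numerical recurrence. The coefficients of the exchange
  polynomials are kept free of the \<open>Y j\<close>: this gives them degree zero and makes the
  \<open>Y\<close>-exponents of the tropical value depend on the c-vector alone.\<close>

definition tracks ::
  "int ^ 'n ^ 'n \<Rightarrow> ('n::finite \<Rightarrow> nat) \<Rightarrow> ('n \<Rightarrow> int) \<Rightarrow> 'n cg_data
     \<Rightarrow> ('n ratfun, 'n coef_var trop, 'n) seed \<Rightarrow> bool" where
  "tracks B d r N S \<longleftrightarrow>
     skew_data r N \<and> dual_data B N \<and>
     (\<forall>i. length (polys S i) = Suc (d i)) \<and>
     (\<forall>i j. \<forall>p\<in>set (polys S i). cexp p (Y j) = 0) \<and>
     (\<forall>i j. exch S $ i $ j = bmat N i j) \<and>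
     (\<forall>i j. cexp (coeffs S j) (Y i) = cmat N i j) \<and>
     (\<forall>j. pos_homogeneous B (cluster S j) (\<chi> i. gmat N i j))"

context
  fixes B :: "int ^ 'n ^ 'n" and d :: "'n::finite \<Rightarrow> nat" and r N S
  assumes S: "tracks B d r N S"
begin

lemma tracks_simps:
  "skew_data r N" "dual_data B N" "length (polys S i) = Suc (d i)" "polys S i \<noteq> []"
  "p \<in> set (polys S i) \<Longrightarrow> cexp p (Y j) = 0"
  "exch S $ i $ j = bmat N i j" "cexp (coeffs S j) (Y i) = cmat N i j" "degs S i = d i"
  "bmat N i i = 0"
  using S skew_data_diagonal by (auto simp: tracks_def degs_def simp flip: length_0_conv)

lemma tracks_cluster: "pos_homogeneous B (cluster S j) (\<chi> i. gmat N i j)"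
  using S by (simp add: tracks_def)

text \<open>The coefficient contributes minus column \<open>k\<close> of \<open>B\<close> times
  \<open>cmat\<close>, the cluster variables column \<open>k\<close> of \<open>gmat\<close> times
  \<open>bmat\<close>; by \<open>dual_data\<close> these cancel.\<close>

lemma tracks_yhat: "pos_homogeneous B (yhat trop_to_ratfun S k) 0"
proof -
  have "trop_degree B (coeffs S k) + (\<Sum>l\<in>UNIV. bmat N l k *s (\<chi> i. gmat N i l)) = 0"
    using tracks_simps(2)
    by (simp add: vec_eq_iff trop_degree_def tracks_simps dual_data_def mult_ac)
  moreover have "pos_homogeneous B (yhat trop_to_ratfun S k)
      (trop_degree B (coeffs S k) + (\<Sum>l\<in>UNIV. bmat N l k *s (\<chi> i. gmat N i l)))"
    unfolding yhat_def tracks_simps(6)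
    by (intro pos_homogeneous_mult pos_homogeneous_prod pos_homogeneous_powi
        pos_homogeneous_trop tracks_cluster)
  ultimately show ?thesis by simp
qed

text \<open>Every summand is positive of degree zero, so their sum is nonzero and again of degree
  zero.\<close>

lemma tracks_eval_field:
  "pos_homogeneous B (eval_field trop_to_ratfun (polys S k) (yhat trop_to_ratfun S k)) 0"
  unfolding eval_field_def
proof (rule pos_homogeneous_sum)
  fix s assume "s \<in> {..<length (polys S k)}"
  then have "cexp (polys S k ! s) (Y j) = 0" for j
    by (intro tracks_simps(5)[of _ k] nth_mem) simp
  then have "trop_degree B (polys S k ! s) = 0"
    by (simp add: trop_degree_def vec_eq_iff)
  then show "pos_homogeneous B
      (trop_to_ratfun (polys S k ! s) * yhat trop_to_ratfun S k ^ s) 0"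
    using pos_homogeneous_mult[OF pos_homogeneous_trop[of B "polys S k ! s"]
        pos_homogeneous_power[OF tracks_yhat[of k], of s]] by simp
qed (use tracks_simps(4) in auto)

lemma tracks_mutate: "tracks B d r (cg_mutate B d k N) (mutate trop_to_ratfun k S)"
  unfolding tracks_def
proof (intro conjI allI ballI)
  let ?S' = "mutate trop_to_ratfun k S" and ?N' = "cg_mutate B d k N"
  let ?Zy = "eval_semifield (polys S k) (coeffs S k)"
  have Zy: "cexp ?Zy (Y i) = - (int (d k) * [- cmat N i k]\<^sub>+)" for i
    by (subst cexp_eval_semifield_const) (auto simp: tracks_simps)
  show "skew_data r ?N'" by (rule skew_data_mutate[OF tracks_simps(1)])
  show "dual_data B ?N'" by (rule dual_data_mutate[OF tracks_simps(2,9)])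
  show "length (polys ?S' i) = Suc (d i)" for i
    by (simp add: mutate_sel tracks_simps)
  show "cexp p (Y j) = 0" if "p \<in> set (polys ?S' i)" for i j p
    using that by (auto simp: mutate_sel tracks_simps split: if_splits)
  show "exch ?S' $ i $ j = bmat ?N' i j" for i j
    by (simp add: mutate_sel cg_mutate_sel tracks_simps)
  show "cexp (coeffs ?S' j) (Y i) = cmat ?N' i j" for i j
    by (simp add: mutate_sel cg_mutate_sel tracks_simps Zy algebra_simps)
  show "pos_homogeneous B (cluster ?S' j) (\<chi> i. gmat ?N' i j)" for j
  proof (cases "j = k")
    case True
    \<comment> \<open>The degrees of the factors in the exchange relation: the monomial, the
      polynomial at \<open>yhat\<close> (degree \<open>0\<close>) over its tropical value, and the
      old cluster variable as denominator.\<close>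
    let ?g = "int (d k) *s (\<Sum>l\<in>UNIV. [- bmat N l k]\<^sub>+ *s (\<chi> i. gmat N i l))
      + (0 - trop_degree B ?Zy) - (\<chi> i. gmat N i k)"
    have "?g = (\<chi> i. gmat ?N' i k)"
      by (simp add: vec_eq_iff cg_mutate_sel trop_degree_def Zy sum_distrib_left sum_negf mult_ac)
    moreover have "pos_homogeneous B (cluster ?S' k) ?g"
      unfolding mutate_sel if_P[OF refl] tracks_simps(6,8)
      by (intro pos_homogeneous_mult pos_homogeneous_divide pos_homogeneous_power
          pos_homogeneous_prod pos_homogeneous_powi pos_homogeneous_trop tracks_cluster
          tracks_eval_field)
    ultimately show ?thesis using True by simp
  next
    case False
    then show ?thesis using tracks_cluster[of j] by (simp add: mutate_sel cg_mutate_sel)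
  qed
qed

text \<open>The second mutation inverts \<open>yhat\<close> and the coefficient, and the reversed
  polynomial turns this into powers of both, which the two exchange monomials absorb. Tracking
  supplies the nonvanishing for the divisions and the zero diagonal.\<close>

lemma tracks_mutate_mutate: "mutate trop_to_ratfun k (mutate trop_to_ratfun k S) = S"
proof (rule seed.equality)
  let ?\<iota> = "trop_to_ratfun :: 'n coef_var trop \<Rightarrow> 'n ratfun"
  let ?S' = "mutate ?\<iota> k S"
  let ?x = "cluster S" and ?y = "coeffs S k" and ?b = "bmat N"
  let ?Zy = "eval_semifield (polys S k) ?y"
  have b': "exch ?S' $ l $ k = - ?b l k" "exch ?S' $ k $ l = - ?b k l" for l
    by (simp_all add: mutate_sel tracks_simps)
  have y': "coeffs ?S' k = inverse ?y" by (simp add: mutate_sel)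
  have p': "polys ?S' k = rev (polys S k)" by (simp add: mutate_sel)
  have Zy': "eval_semifield (rev (polys S k)) (inverse ?y) = inverse (?y ^ d k) * ?Zy"
    by (simp add: eval_semifield_rev tracks_simps)
  show "polys (mutate ?\<iota> k ?S') = polys S" by (simp add: mutate_sel)
  show "exch (mutate ?\<iota> k ?S') = exch S"
    by (auto simp: vec_eq_iff mutate_sel tracks_simps max_def algebra_simps)
  \<comment> \<open>Exponents of all variables are compared, although \<open>tracks\<close> controls
    only those of the \<open>Y i\<close>: \<open>Zy'\<close> is an identity in the semifield
    itself.\<close>
  show "coeffs (mutate ?\<iota> k ?S') = coeffs S"
  proof (rule ext, rule trop_eqI)
    fix j v
    show "cexp (coeffs (mutate ?\<iota> k ?S') j) v = cexp (coeffs S j) v"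
      unfolding mutate_sel(2)[of ?\<iota> k ?S'] p' y' b' Zy' degs_mutate
      by (auto simp: mutate_sel tracks_simps max_def algebra_simps)
  qed
  show "cluster (mutate ?\<iota> k ?S') = ?x"
  proof
    fix i
    show "cluster (mutate ?\<iota> k ?S') i = ?x i"
    proof (cases "i = k")
      case True
      have x0: "?x l \<noteq> 0" for l using pos_homogeneous_nonzero[OF tracks_cluster] .
      \<comment> \<open>Any grading proves nonvanishing; the zero matrix is an arbitrary
        choice.\<close>
      have \<iota>0: "?\<iota> p \<noteq> 0" for p using pos_homogeneous_nonzero[OF pos_homogeneous_trop[of 0]] .
      have \<iota>inv: "?\<iota> (inverse p) = inverse (?\<iota> p)" for p
      proof -
        have "?\<iota> (inverse p) * ?\<iota> p = 1"
          by (metis trop_to_ratfun_mult trop_to_ratfun_one semifield_left_inverse)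
        then show ?thesis by (metis inverse_unique inverse_inverse_eq)
      qed
      have \<iota>pow: "?\<iota> (p ^ n) = ?\<iota> p ^ n" for p n
        by (induction n) (simp_all add: trop_to_ratfun_one trop_to_ratfun_mult)
      define u where "u = yhat ?\<iota> S k"
      have u0: "u \<noteq> 0" unfolding u_def by (rule pos_homogeneous_nonzero[OF tracks_yhat])
      define M where "M = (\<Prod>l\<in>UNIV. ?x l powi [- ?b l k]\<^sub>+)"
      define M' where "M' = (\<Prod>l\<in>UNIV. ?x l powi [?b l k]\<^sub>+)"
      define E where "E = eval_field ?\<iota> (polys S k) u"
      have E0: "E \<noteq> 0" unfolding E_def u_def
        by (rule pos_homogeneous_nonzero[OF tracks_eval_field])
      have M0: "M \<noteq> 0" unfolding M_def using x0 by simp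
      \<comment> \<open>Mutation changes only the variable with index \<open>k\<close>, which occurs
        here with exponent zero.\<close>
      have prod': "(\<Prod>l\<in>UNIV. cluster ?S' l powi f l) = (\<Prod>l\<in>UNIV. ?x l powi f l)"
        if "f k = 0" for f
        by (intro prod.cong refl) (use that in \<open>auto simp: mutate_sel\<close>)
      \<comment> \<open>Exponentwise this is \<open>[-b]_+ + b = [b]_+\<close>.\<close>
      have "M * (\<Prod>l\<in>UNIV. ?x l powi ?b l k) = M'"
        unfolding M_def M'_def prod.distrib[symmetric]
        by (intro prod.cong refl)
          (auto simp: max_def power_int_add[symmetric] x0)
      then have Mu: "M' * ?\<iota> ?y = M * u"
        by (auto simp: u_def yhat_def tracks_simps)
      have "yhat ?\<iota> ?S' k = inverse (?\<iota> ?y) * (\<Prod>l\<in>UNIV. ?x l powi (- ?b l k))"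
        unfolding yhat_def y' b' \<iota>inv by (simp add: prod' tracks_simps)
      also have "\<dots> = inverse u"
        by (simp add: u_def yhat_def tracks_simps power_int_minus prod_inversef[symmetric] o_def)
      finally have E': "eval_field ?\<iota> (polys ?S' k) (yhat ?\<iota> ?S' k) = E / u ^ d k"
        unfolding p' E_def using u0 by (simp add: eval_field_rev tracks_simps)
      have M'': "(\<Prod>l\<in>UNIV. cluster ?S' l powi [- (exch ?S' $ l $ k)]\<^sub>+) = M'"
        unfolding b' M'_def by (simp add: prod' tracks_simps)
      have xk: "cluster ?S' k = M ^ d k * (E / ?\<iota> ?Zy) / ?x k"
        by (simp add: mutate_sel tracks_simps M_def E_def u_def)
      have "cluster (mutate ?\<iota> k ?S') k
          = M' ^ d k * ((E / u ^ d k) / (inverse (?\<iota> ?y ^ d k) * ?\<iota> ?Zy)) / cluster ?S' k"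
        unfolding mutate_sel(1)[of ?\<iota> k ?S'] if_P[OF refl] E' M'' degs_mutate
        unfolding p' y' Zy'
        by (simp add: trop_to_ratfun_mult \<iota>inv \<iota>pow tracks_simps)
      \<comment> \<open>The powers are gathered into one ratio, which \<open>Mu\<close> shows to be
        1.\<close>
      also have "\<dots> = (M' * ?\<iota> ?y) ^ d k / (M * u) ^ d k * ?x k"
        unfolding xk power_mult_distrib using u0 M0 E0 x0 \<iota>0 by (simp add: field_simps)
      also have "\<dots> = ?x k" unfolding Mu using M0 u0 by simp
      finally show ?thesis using True by simp
    next
      case False
      then show ?thesis by (simp add: mutate_sel)
    qed
  qed
qed simp

end

section \<open>From single mutations to all vertices of the tree\<close>

lemma tracks_fold:
  "tracks B d r N S \<Longrightarrow>
     tracks B d r (fold (cg_mutate B d) ks N) (fold (mutate trop_to_ratfun) ks S)"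
  by (induction ks arbitrary: N S) (auto intro: tracks_mutate)

lemma tracks_initial:
  assumes "\<And>i. r i > 0" "\<And>i j. r i * B $ i $ j = - (r j * B $ j $ i)"
  shows "tracks B d r (cg_initial B) (universal_seed B d)"
proof -
  have "(\<chi> i. of_bool (i = j)) = (axis j 1 :: int ^ 'a)" for j
    by (simp add: vec_eq_iff axis_def)
  then have "pos_homogeneous B (indet (X j)) (\<chi> i. of_bool (i = j))" for j
    using pos_homogeneous_indet[of B "X j"] by simp
  moreover have "skew_data r (cg_initial B)"
    unfolding skew_data_def cg_initial_def cg_data.simps using assms by blast
  ultimately show ?thesis
    using dual_data_initial[of B]
    by (auto simp: tracks_def universal_seed_def cexp_trop_gen) (auto simp: cg_initial_def)
qed

text \<open>The walk is that of \<open>pattern_from_eq_fold\<close>, without cancelling common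
  letters, so that it matches the fold of seeds letter by letter.\<close>

definition cg_at ::
  "int ^ 'n ^ 'n \<Rightarrow> ('n::finite \<Rightarrow> nat) \<Rightarrow> 'n tree_vertex \<Rightarrow> 'n tree_vertex \<Rightarrow> 'n cg_data" where
  "cg_at B d t0 t = fold (cg_mutate B d) (rev (word_of t0) @ word_of t) (cg_initial B)"

lemma gvec_eq_gmat:
  assumes "skew_symmetrizable B"
  shows "gvec B d t0 t j $ i = gmat (cg_at B d t0 t) i j"
proof -
  obtain r where r: "\<And>i. r i > 0" "\<And>i j. r i * B $ i $ j = - (r j * B $ j $ i)"
    using assms unfolding skew_symmetrizable_def by blast
  note init = tracks_initial[of r, OF r, of d]
  let ?ks = "rev (word_of t0) @ word_of t"
  \<comment> \<open>The class on which mutation is involutive consists of the seeds tracked by some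
    data.\<close>
  have "pattern_from trop_to_ratfun t0 (universal_seed B d) t
      = fold (mutate trop_to_ratfun) ?ks (universal_seed B d)"
    by (rule pattern_from_eq_fold[where I = "\<lambda>S. \<exists>N. tracks B d r N S"])
      (use init tracks_mutate tracks_mutate_mutate in blast)+
  then have hom: "homogeneous B (X_function B d t0 t j) (\<chi> i. gmat (cg_at B d t0 t) i j)"
    using tracks_cluster[OF tracks_fold[OF init, of ?ks]]
    by (simp add: X_function_def cg_at_def pos_homogeneous_imp_homogeneous)
  have "gvec B d t0 t j = (\<chi> i. gmat (cg_at B d t0 t) i j)"
    unfolding gvec_def by (rule the_equality) (rule hom, erule homogeneous_unique[OF _ hom])
  then show ?thesis by simp
qed


section \<open>Companions\<close>

lemma fold_invariant2:
  assumes "\<And>k x y. R x y \<Longrightarrow> R (f k x) (g k y)" "R x y"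
  shows "R (fold f ks x) (fold g ks y)"
  using assms(2) by (induction ks arbitrary: x y) (auto intro: assms(1))

lemma pos_part_mult_nat:
  "[int a * b]\<^sub>+ = int a * [b]\<^sub>+" "[- (int a * b)]\<^sub>+ = int a * [- b]\<^sub>+"
  "[b * int a]\<^sub>+ = [b]\<^sub>+ * int a" "[- (b * int a)]\<^sub>+ = [- b]\<^sub>+ * int a"
  using pos_part_mult[of "int a" b] pos_part_mult[of "int a" "- b"] by (simp_all add: mult.commute)

lemma degree_matrix_mult:
  "(degree_matrix S ** B) $ i $ j = int (degs S i) * B $ i $ j"
  "(B ** degree_matrix S) $ i $ j = B $ i $ j * int (degs S j)"
  by (simp_all add: matrix_matrix_mult_def degree_matrix_def if_distrib if_distribR cong: if_cong)

text \<open>Every mutation preserves \<open>B' = BD\<close>, \<open>DC' = CD\<close> and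
  \<open>G' = G\<close>, since positive parts commute with nonnegative factors. The relation for
  \<open>C\<close> is stated without division to stay among integers.\<close>

lemma right_companion_gmat:
  fixes B B' :: "int ^ 'n::finite ^ 'n"
  assumes B': "\<And>i j. B' $ i $ j = B $ i $ j * int (d j)"
  shows "gmat (cg_at B' (\<lambda>_. 1) t0 t) i j = gmat (cg_at B d t0 t) i j"
proof -
  define R where "R N N' \<longleftrightarrow>
      (\<forall>i j. bmat N' i j = bmat N i j * int (d j)) \<and>
      (\<forall>i j. int (d i) * cmat N' i j = cmat N i j * int (d j)) \<and>
      (\<forall>i j. gmat N' i j = gmat N i j)" for N N' :: "'n cg_data"
  have "R (cg_mutate B d k N) (cg_mutate B' (\<lambda>_. 1) k N')" if N: "R N N'" for k N N'
  proof -
    have b: "bmat N' i j = bmat N i j * int (d j)" and g: "gmat N' i j = gmat N i j"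
      and c: "int (d i) * cmat N' i j = cmat N i j * int (d j)" for i j
      using N by (auto simp: R_def)
    have c': "int (d i) * [- cmat N' i j]\<^sub>+ = [- cmat N i j]\<^sub>+ * int (d j)" for i j
      using c[of i j] pos_part_mult_nat(2)[of "d i" "cmat N' i j"]
        pos_part_mult_nat(4)[of "cmat N i j" "d j"] by simp
    have "int (d i) * cmat (cg_mutate B' (\<lambda>_. 1) k N') i j
        = cmat (cg_mutate B d k N) i j * int (d j)" for i j
    proof (cases "j = k")
      case False
      have "int (d i) * cmat (cg_mutate B' (\<lambda>_. 1) k N') i j
          = int (d i) * cmat N' i j + (int (d i) * cmat N' i k) * [bmat N' k j]\<^sub>+
            + (int (d i) * [- cmat N' i k]\<^sub>+) * bmat N' k j"
        using False by (simp add: cg_mutate_sel algebra_simps)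
      also have "\<dots> = cmat (cg_mutate B d k N) i j * int (d j)"
        unfolding c c' b pos_part_mult_nat using False by (simp add: cg_mutate_sel algebra_simps)
      finally show ?thesis .
    qed (simp add: cg_mutate_sel c)
    moreover have "bmat (cg_mutate B' (\<lambda>_. 1) k N') i j
        = bmat (cg_mutate B d k N) i j * int (d j)" for i j
      by (simp add: cg_mutate_sel b pos_part_mult_nat algebra_simps)
    moreover have "gmat (cg_mutate B' (\<lambda>_. 1) k N') i j = gmat (cg_mutate B d k N) i j" for i j
    proof -
      \<comment> \<open>The column factors \<open>d l\<close> of \<open>B'\<close> convert c-vectors
        of the companion into those of the original, releasing the factor \<open>d k\<close> of the
        generalized recurrence.\<close>
      have "(\<Sum>l\<in>UNIV. B' $ i $ l * [- cmat N' l k]\<^sub>+)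
          = (\<Sum>l\<in>UNIV. B $ i $ l * (int (d l) * [- cmat N' l k]\<^sub>+))"
        by (simp add: B' mult_ac)
      also have "\<dots> = int (d k) * (\<Sum>l\<in>UNIV. B $ i $ l * [- cmat N l k]\<^sub>+)"
        unfolding c' by (simp add: sum_distrib_left mult_ac)
      finally have s: "(\<Sum>l\<in>UNIV. B' $ i $ l * [- cmat N' l k]\<^sub>+)
          = int (d k) * (\<Sum>l\<in>UNIV. B $ i $ l * [- cmat N l k]\<^sub>+)" .
      show ?thesis unfolding cg_mutate_sel s
        by (simp add: b g pos_part_mult_nat sum_distrib_left mult_ac)
    qed
    ultimately show ?thesis by (simp add: R_def)
  qed
  moreover have "R (cg_initial B) (cg_initial B')"
    by (auto simp: R_def cg_initial_def B')
  ultimately have "R (cg_at B d t0 t) (cg_at B' (\<lambda>_. 1) t0 t)"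
    unfolding cg_at_def by (intro fold_invariant2[where R = R])
  then show ?thesis by (simp add: R_def)
qed

text \<open>Here the preserved relations are \<open>B' = DB\<close>, \<open>C' = C\<close> and
  \<open>G'D = DG\<close>.\<close>

lemma left_companion_gmat:
  fixes B B' :: "int ^ 'n::finite ^ 'n"
  assumes B': "\<And>i j. B' $ i $ j = int (d i) * B $ i $ j"
  shows "gmat (cg_at B' (\<lambda>_. 1) t0 t) i j * int (d j) = int (d i) * gmat (cg_at B d t0 t) i j"
proof -
  define R where "R N N' \<longleftrightarrow>
      (\<forall>i j. bmat N' i j = int (d i) * bmat N i j) \<and>
      (\<forall>i j. cmat N' i j = cmat N i j) \<and>
      (\<forall>i j. gmat N' i j * int (d j) = int (d i) * gmat N i j)" for N N' :: "'n cg_data"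
  have "R (cg_mutate B d k N) (cg_mutate B' (\<lambda>_. 1) k N')" if N: "R N N'" for k N N'
  proof -
    have b: "bmat N' i j = int (d i) * bmat N i j" and c: "cmat N' i j = cmat N i j"
      and g: "gmat N' i j * int (d j) = int (d i) * gmat N i j" for i j
      using N by (auto simp: R_def)
    \<comment> \<open>The row factor \<open>d k\<close> of \<open>bmat N' k j\<close> replaces the
      degree, which is 1 for the companion.\<close>
    have "bmat (cg_mutate B' (\<lambda>_. 1) k N') i j = int (d i) * bmat (cg_mutate B d k N) i j" for i j
      by (simp add: cg_mutate_sel b pos_part_mult_nat algebra_simps)
    moreover have "cmat (cg_mutate B' (\<lambda>_. 1) k N') i j = cmat (cg_mutate B d k N) i j" for i j
      by (simp add: cg_mutate_sel b c pos_part_mult_nat algebra_simps)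
    moreover have "gmat (cg_mutate B' (\<lambda>_. 1) k N') i j * int (d j)
        = int (d i) * gmat (cg_mutate B d k N) i j" for i j
    proof (cases "j = k")
      case True
      \<comment> \<open>The row factor \<open>d l\<close> of the companion matrix is absorbed by
        column \<open>l\<close> of \<open>gmat N'\<close>.\<close>
      have "(\<Sum>l\<in>UNIV. [- bmat N' l k]\<^sub>+ * gmat N' i l)
          = (\<Sum>l\<in>UNIV. [- bmat N l k]\<^sub>+ * (gmat N' i l * int (d l)))"
        by (simp add: b pos_part_mult_nat mult_ac)
      also have "\<dots> = int (d i) * (\<Sum>l\<in>UNIV. [- bmat N l k]\<^sub>+ * gmat N i l)"
        unfolding g by (simp add: sum_distrib_left mult_ac)
      finally have s: "(\<Sum>l\<in>UNIV. [- bmat N' l k]\<^sub>+ * gmat N' i l)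
          = int (d i) * (\<Sum>l\<in>UNIV. [- bmat N l k]\<^sub>+ * gmat N i l)" .
      have s': "(\<Sum>l\<in>UNIV. B' $ i $ l * [- cmat N' l k]\<^sub>+)
          = int (d i) * (\<Sum>l\<in>UNIV. B $ i $ l * [- cmat N l k]\<^sub>+)"
        by (simp add: B' c sum_distrib_left mult_ac)
      show ?thesis unfolding True cg_mutate_sel if_P[OF refl] s s'
        using g[of i k] by (simp add: algebra_simps)
    qed (simp add: cg_mutate_sel g)
    ultimately show ?thesis by (simp add: R_def)
  qed
  moreover have "R (cg_initial B) (cg_initial B')"
    by (auto simp: R_def cg_initial_def B')
  ultimately have "R (cg_at B d t0 t) (cg_at B' (\<lambda>_. 1) t0 t)"
    unfolding cg_at_def by (intro fold_invariant2[where R = R])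
  then show ?thesis by (simp add: R_def)
qed

text \<open>If \<open>r i\<close> symmetrizes \<open>B\<close>, then \<open>r i * d i\<close> serves
  for \<open>BD\<close> and \<open>r i / d i\<close> for \<open>DB\<close>; the latter is made
  integral by the product of all degrees.\<close>

lemma skew_symmetrizable_companions:
  fixes S :: "('f, 'p, 'n::finite) seed"
  assumes B: "skew_symmetrizable (exch S)" and d: "\<And>i. degs S i \<ge> 1"
  shows "skew_symmetrizable (degree_matrix S ** exch S)"
    and "skew_symmetrizable (exch S ** degree_matrix S)"
proof -
  obtain r where r: "\<And>i. r i > 0"
    and skew: "\<And>i j. r i * exch S $ i $ j = - (r j * exch S $ j $ i)"
    using B unfolding skew_symmetrizable_def by blast
  have d0: "0 < int (degs S i)" for i using d[of i] by simp
  show "skew_symmetrizable (exch S ** degree_matrix S)"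
    unfolding skew_symmetrizable_def degree_matrix_mult
  proof (intro exI[of _ "\<lambda>i. r i * int (degs S i)"] conjI allI)
    fix i j
    have "(r i * exch S $ i $ j) * (int (degs S i) * int (degs S j))
        = - (r j * exch S $ j $ i) * (int (degs S i) * int (degs S j))" by (subst skew) (rule refl)
    then show "r i * int (degs S i) * (exch S $ i $ j * int (degs S j))
        = - (r j * int (degs S j) * (exch S $ j $ i * int (degs S i)))"
      by (simp add: mult_ac)
  qed (intro mult_pos_pos r d0)
  let ?D = "\<lambda>i. \<Prod>l\<in>UNIV - {i}. int (degs S l)"
  have D: "?D i * int (degs S i) = (\<Prod>l\<in>UNIV. int (degs S l))" for i
    by (simp add: prod.remove[of UNIV i] mult.commute)
  show "skew_symmetrizable (degree_matrix S ** exch S)"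
    unfolding skew_symmetrizable_def degree_matrix_mult
  proof (intro exI[of _ "\<lambda>i. r i * ?D i"] conjI allI)
    fix i j
    have "r i * ?D i * (int (degs S i) * exch S $ i $ j)
        = (?D i * int (degs S i)) * (r i * exch S $ i $ j)" by (simp add: mult_ac)
    also have "\<dots> = - ((?D j * int (degs S j)) * (r j * exch S $ j $ i))"
      unfolding D skew[of i j] by simp
    finally show "r i * ?D i * (int (degs S i) * exch S $ i $ j)
        = - (r j * ?D j * (int (degs S j) * exch S $ j $ i))" by (simp add: mult_ac)
  next
    show "0 < r i * ?D i" for i using r d0 by (simp add: prod_pos)
  qed
qed

theorem corollary4p2:
  fixes \<iota> :: "'p::semifield \<Rightarrow> 'f::field"
    and S :: "('f, 'p, 'n::finite) seed"
    and \<epsilon> :: "'f \<Rightarrow> 'g::field" and w :: "'n \<Rightarrow> 'g"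
    and t0 t :: "'n tree_vertex" and i j :: 'n
  assumes "generalized_seed \<iota> S"
    and "field_embedding \<epsilon>" and "are_cluster_roots \<epsilon> S w"
  shows "g_vector (right_companion S) t0 t j $ i = g_vector S t0 t j $ i
       \<and> (of_int (g_vector (left_companion w S) t0 t j $ i) :: rat)
           = of_nat (degs S i) * of_int (g_vector S t0 t j $ i) * inverse (of_nat (degs S j))"
proof -
  have B: "skew_symmetrizable (exch S)" and d: "\<And>i. degs S i \<ge> 1"
    using assms(1) by (auto simp: generalized_seed_def)
  \<comment> \<open>The type \<open>'h\<close> is left open because the clusters of the two
    companions live in different fields.\<close>
  have d1: "degs (ordinary_seed x y A) = (\<lambda>_. 1)"
    for x :: "'n \<Rightarrow> 'h" and y :: "'n \<Rightarrow> 'p" and A :: "int ^ 'n ^ 'n"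
    by (simp add: fun_eq_iff degs_def ordinary_seed_def)
  have "g_vector (right_companion S) t0 t j $ i = g_vector S t0 t j $ i"
    unfolding g_vector_def right_companion_def d1
    using gvec_eq_gmat[OF B] gvec_eq_gmat[OF skew_symmetrizable_companions(2)[OF B d]]
      right_companion_gmat[where B' = "exch S ** degree_matrix S" and B = "exch S" and d = "degs S",
        OF degree_matrix_mult(2)]
    by (simp add: ordinary_seed_def)
  \<comment> \<open>Proved over the integers first; the division by \<open>d j\<close> is then
    carried out over the rationals.\<close>
  moreover have "g_vector (left_companion w S) t0 t j $ i * int (degs S j)
      = int (degs S i) * g_vector S t0 t j $ i"
    unfolding g_vector_def left_companion_def d1
    using gvec_eq_gmat[OF B] gvec_eq_gmat[OF skew_symmetrizable_companions(1)[OF B d]]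
      left_companion_gmat[where B' = "degree_matrix S ** exch S" and B = "exch S" and d = "degs S",
        OF degree_matrix_mult(1)]
    by (simp add: ordinary_seed_def)
  then have "(of_int (g_vector (left_companion w S) t0 t j $ i) :: rat) * of_nat (degs S j)
      = of_nat (degs S i) * of_int (g_vector S t0 t j $ i)"
    by (metis of_int_mult of_int_of_nat_eq)
  moreover have "(of_nat (degs S j) :: rat) \<noteq> 0" using d[of j] by simp
  ultimately show ?thesis by (simp add: field_simps)
qed

end
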